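(* Let $0<\alpha<1$, $l>0$, $T>0$, $r\ge 1$, let $p\in C([0,T])$ with $p\ge 0$, $\varphi\in H^2(0,l)\cap H_0^1(0,l)$, and $f\in C(\overline{Q}_T)$, where $Q_T=\{(x,t):0<x<l,\ 0\le t\le T\}$. Let $u$ be the exact solution of $$\partial_t^{\alpha} u(x,t)-u_{xx}(x,t)+p(t)u(x,t)=f(x,t),\ (x,t)\in Q_T,\qquad u(x,0)=\varphi(x),\ x\in[0,l],\qquad u(0,t)=u(l,t)=0,\ t\in[0,T],$$ and assume that there is a constant $C_u$ such that for all $(x,t)\in[0,l]\times(0,T]$ $$\Big|\frac{\partial^k u}{\partial x^k}(x,t)\Big|\le C_u\ \ (k=0,1,2,3,4),\qquad \Big|\frac{\partial^\ell u}{\partial t^\ell}(x,t)\Big|\le C_u\big(1+t^{\alpha-\ell}\big)\ \ (\ell=0,1,2).$$ For positive integers $N\ge 2$ and $M$, let $h=l/N$, $x_i=ih$, $t_k=T(k/M)^r$, $\tau_k=t_k-t_{k-1}$, and let $\{u_i^k\}_{0\le i\le N,\,0\le k\le M}$ be the solution of the fully implicit scheme $$\frac{1}{\Gamma(2-\alpha)}\sum_{j=1}^k d_{k,j}\big(u_i^j-u_i^{j-1}\big)-\frac{u_{i+1}^k-2u_i^k+u_{i-1}^k}{h^2}+p(t_k)u_i^k=f(x_i,t_k),\quad 1\le i\le N-1,\ 1\le k\le M,$$ with $u_i^0=\varphi(x_i)$ for $0\le i\le N$ and $u_0^k=u_N^k=0$ for $0\le k\le M$, where $$d_{k,j}=\frac{(t_k-t_{j-1})^{1-\alpha}-(t_k-t_j)^{1-\alpha}}{\tau_j},\qquad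 1\le j\le k\le M.$$ Then the numerical solution converges to the exact solution with the error bound $$\max_{0\le k\le M}\|u(\cdot,t_k)-u^k\|_\infty\le C\Big(M^{-\min\{2-\alpha,\;r\alpha\}}+h^2\Big),$$ where $C>0$ is a constant independent of $h$ and $M$.
   Context: $\partial_t^\alpha$ is the Caputo fractional derivative in time of order $\alpha\in(0,1)$: $\partial_t^\alpha u(x,t)=\frac{1}{\Gamma(1-\alpha)}\int_0^t\frac{u_s(x,s)}{(t-s)^\alpha}\,ds$ (at $t=0$ understood by continuous extension). The exact solution is a function $u$ on $\overline{Q}_T$ with $u(\cdot,t)\in C^2[0,l]$ for each $t$, and, for each $x$, $u(x,\cdot)\in C[0,T]$ with $\partial_t^\alpha u(x,\cdot)\in C[0,T]$, satisfying the equation, initial and boundary conditions; the derivatives in the regularity bounds are assumed to exist. The norm is the discrete maximum norm over the spatial grid: $\|u(\cdot,t_k)-u^k\|_\infty=\max_{0\le i\le N}|u(x_i,t_k)-u_i^k|$. *)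

theory Defs
  imports "HOL-Analysis.Analysis"
begin

section \<open>Classical derivatives on an interval\<close>

text \<open>
  The \<^term>\<open>k\<close>-th derivative relative to a set \<^term>\<open>S\<close>; at an endpoint belonging to an
  interval \<^term>\<open>S\<close> this is the one-sided derivative. It is meaningful only together with
  \<open>times_differentiable_on\<close>.
\<close>

definition nth_deriv_on :: "real set \<Rightarrow> nat \<Rightarrow> (real \<Rightarrow> real) \<Rightarrow> real \<Rightarrow> real" where
  "nth_deriv_on S k = (\<lambda>g x. vector_derivative g (at x within S)) ^^ k"

definition times_differentiable_on :: "nat \<Rightarrow> (real \<Rightarrow> real) \<Rightarrow> real set \<Rightarrow> bool" where
  "times_differentiable_on n g S \<longleftrightarrow> (\<forall>k<n. nth_deriv_on S k g differentiable_on S)"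

definition times_cont_differentiable_on :: "nat \<Rightarrow> (real \<Rightarrow> real) \<Rightarrow> real set \<Rightarrow> bool" where
  "times_cont_differentiable_on n g S \<longleftrightarrow>
     times_differentiable_on n g S \<and> continuous_on S (nth_deriv_on S n g)"


section \<open>Sobolev spaces on a bounded interval\<close>

text \<open>
  Functions on \<open>(a, b)\<close> are represented by functions on the real line, of which only the
  values in \<open>(a, b)\<close> matter.
\<close>

definition L2_interval :: "real \<Rightarrow> real \<Rightarrow> (real \<Rightarrow> real) set" where
  "L2_interval a b =
     {g. set_borel_measurable lebesgue {a<..<b} g \<and>
         set_integrable lebesgue {a<..<b} (\<lambda>x. (g x)\<^sup>2)}"

definition test_functions :: "real \<Rightarrow> real \<Rightarrow> (real \<Rightarrow> real) set" where
  "test_functions a b =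
     {\<psi>. (\<forall>k x. (deriv ^^ k) \<psi> differentiable (at x)) \<and>
         (\<exists>c d. a < c \<and> d < b \<and> (\<forall>x. x \<notin> {c..d} \<longrightarrow> \<psi> x = 0))}"

definition weak_deriv :: "real \<Rightarrow> real \<Rightarrow> nat \<Rightarrow> (real \<Rightarrow> real) \<Rightarrow> (real \<Rightarrow> real) \<Rightarrow> bool" where
  "weak_deriv a b k g g' \<longleftrightarrow>
     (\<forall>\<psi>\<in>test_functions a b.
        (LINT x:{a<..<b}|lebesgue. g x * (deriv ^^ k) \<psi> x) =
        (-1) ^ k * (LINT x:{a<..<b}|lebesgue. g' x * \<psi> x))"

definition sobolev_H :: "nat \<Rightarrow> real \<Rightarrow> real \<Rightarrow> (real \<Rightarrow> real) set" where
  "sobolev_H m a b =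
     {g \<in> L2_interval a b. \<forall>k\<in>{1..m}. \<exists>g'\<in>L2_interval a b. weak_deriv a b k g g'}"

text \<open>The closure of the test functions in the norm of \<open>H\<^sup>1(a, b)\<close>.\<close>

definition sobolev_H10 :: "real \<Rightarrow> real \<Rightarrow> (real \<Rightarrow> real) set" where
  "sobolev_H10 a b =
     {g \<in> sobolev_H 1 a b.
        \<exists>g'\<in>L2_interval a b. weak_deriv a b 1 g g' \<and>
          (\<exists>\<psi>. (\<forall>n::nat. \<psi> n \<in> test_functions a b) \<and>
             (\<lambda>n. (LINT x:{a<..<b}|lebesgue. (\<psi> n x - g x)\<^sup>2) +
                  (LINT x:{a<..<b}|lebesgue. (deriv (\<psi> n) x - g' x)\<^sup>2)) \<longlonglongrightarrow> 0)}"


section \<open>The Caputo derivative\<close>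

definition caputo_integral :: "real \<Rightarrow> (real \<Rightarrow> real) \<Rightarrow> real \<Rightarrow> real" where
  "caputo_integral \<alpha> g t =
     1 / Gamma (1 - \<alpha>) * (LINT s:{0<..<t}|lebesgue. deriv g s / (t - s) powr \<alpha>)"

text \<open>
  The value at \<open>t = 0\<close> is the continuous extension; if the right limit does not exist, then
  the resulting function is not continuous at \<open>0\<close> relative to \<open>[0, T]\<close>.
\<close>

definition caputo :: "real \<Rightarrow> (real \<Rightarrow> real) \<Rightarrow> real \<Rightarrow> real" where
  "caputo \<alpha> g t =
     (if t = 0 then Lim (at_right 0) (caputo_integral \<alpha> g) else caputo_integral \<alpha> g t)"

text \<open>Excludes the default values of \<^const>\<open>deriv\<close> and of the Lebesgue integral.\<close>

definition caputo_exists_on :: "real \<Rightarrow> (real \<Rightarrow> real) \<Rightarrow> real \<Rightarrow> bool" where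
  "caputo_exists_on \<alpha> g T \<longleftrightarrow>
     (\<forall>s\<in>{0<..<T}. g differentiable (at s)) \<and>
     (\<forall>t\<in>{0<..T}. set_integrable lebesgue {0<..<t} (\<lambda>s. deriv g s / (t - s) powr \<alpha>))"


section \<open>The initial-boundary value problem and its regularity bounds\<close>

definition exact_solution ::
  "real \<Rightarrow> real \<Rightarrow> real \<Rightarrow> (real \<Rightarrow> real) \<Rightarrow> (real \<Rightarrow> real) \<Rightarrow> (real \<Rightarrow> real \<Rightarrow> real) \<Rightarrow>
   (real \<Rightarrow> real \<Rightarrow> real) \<Rightarrow> bool" where
  "exact_solution \<alpha> l T p \<phi> f u \<longleftrightarrow>
     (\<forall>t\<in>{0..T}. times_cont_differentiable_on 2 (\<lambda>x. u x t) {0..l}) \<and>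
     (\<forall>x\<in>{0..l}. continuous_on {0..T} (u x) \<and> caputo_exists_on \<alpha> (u x) T \<and>
        continuous_on {0..T} (caputo \<alpha> (u x))) \<and>
     (\<forall>x\<in>{0<..<l}. \<forall>t\<in>{0..T}.
        caputo \<alpha> (u x) t - nth_deriv_on {0..l} 2 (\<lambda>y. u y t) x + p t * u x t = f x t) \<and>
     (\<forall>x\<in>{0..l}. u x 0 = \<phi> x) \<and>
     (\<forall>t\<in>{0..T}. u 0 t = 0 \<and> u l t = 0)"

definition regularity_bounds ::
  "real \<Rightarrow> real \<Rightarrow> real \<Rightarrow> real \<Rightarrow> (real \<Rightarrow> real \<Rightarrow> real) \<Rightarrow> bool" where
  "regularity_bounds \<alpha> l T C u \<longleftrightarrow>
     (\<forall>t\<in>{0<..T}. times_differentiable_on 4 (\<lambda>x. u x t) {0..l}) \<and>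
     (\<forall>x\<in>{0..l}. times_differentiable_on 2 (u x) {0<..T}) \<and>
     (\<forall>x\<in>{0..l}. \<forall>t\<in>{0<..T}.
        (\<forall>k\<in>{0..4}. \<bar>nth_deriv_on {0..l} k (\<lambda>y. u y t) x\<bar> \<le> C) \<and>
        (\<forall>m\<in>{0..2}. \<bar>nth_deriv_on {0<..T} m (u x) t\<bar> \<le> C * (1 + t powr (\<alpha> - real m))))"


section \<open>The fully implicit scheme on a graded mesh\<close>

text \<open>
  The convention \<^term>\<open>0 powr a = (0::real)\<close> gives \<open>t\<^sub>0 = 0\<close> and makes the second term in the
  numerator of the diagonal weights (\<open>j = k\<close>) vanish.
\<close>

definition grid_point :: "real \<Rightarrow> nat \<Rightarrow> nat \<Rightarrow> real" where
  "grid_point l N i = real i * (l / real N)"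

definition mesh_time :: "real \<Rightarrow> real \<Rightarrow> nat \<Rightarrow> nat \<Rightarrow> real" where
  "mesh_time T r M k = T * (real k / real M) powr r"

definition L1_weight :: "real \<Rightarrow> real \<Rightarrow> real \<Rightarrow> nat \<Rightarrow> nat \<Rightarrow> nat \<Rightarrow> real" where
  "L1_weight \<alpha> T r M k j =
     ((mesh_time T r M k - mesh_time T r M (j - 1)) powr (1 - \<alpha>) -
      (mesh_time T r M k - mesh_time T r M j) powr (1 - \<alpha>)) /
     (mesh_time T r M j - mesh_time T r M (j - 1))"

text \<open>\<open>U i k\<close> is the approximation at the \<open>i\<close>-th grid point and the \<open>k\<close>-th time level.\<close>

definition implicit_scheme_solution ::
  "real \<Rightarrow> real \<Rightarrow> real \<Rightarrow> real \<Rightarrow> (real \<Rightarrow> real) \<Rightarrow> (real \<Rightarrow> real) \<Rightarrow> (real \<Rightarrow> real \<Rightarrow> real) \<Rightarrow>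
   nat \<Rightarrow> nat \<Rightarrow> (nat \<Rightarrow> nat \<Rightarrow> real) \<Rightarrow> bool" where
  "implicit_scheme_solution \<alpha> l T r p \<phi> f N M U \<longleftrightarrow>
     (\<forall>i\<in>{1..N - 1}. \<forall>k\<in>{1..M}.
        1 / Gamma (2 - \<alpha>) * (\<Sum>j = 1..k. L1_weight \<alpha> T r M k j * (U i j - U i (j - 1)))
        - (U (i + 1) k - 2 * U i k + U (i - 1) k) / (l / real N)\<^sup>2
        + p (mesh_time T r M k) * U i k
        = f (grid_point l N i) (mesh_time T r M k)) \<and>
     (\<forall>i\<in>{0..N}. U i 0 = \<phi> (grid_point l N i)) \<and>
     (\<forall>k\<in>{0..M}. U 0 k = 0 \<and> U N k = 0)"

definition discrete_max_norm :: "nat \<Rightarrow> (nat \<Rightarrow> real) \<Rightarrow> real" where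
  "discrete_max_norm N v = Max ((\<lambda>i. \<bar>v i\<bar>) ` {0..N})"

end

theory Submission
  imports Defs
begin

text \<open>
  The error satisfies the scheme with the truncation error as right-hand side. At a grid point where
  the error at level \<open>k\<close> is largest in modulus, the spatial difference and the term with \<open>p\<close> have
  favourable signs, and the weights \<open>d\<^sub>k\<^sub>,\<^sub>j\<close> are positive and increasing in \<open>j\<close>. Hence a constant
  \<open>B\<close> bounds the error as soon as \<open>\<Gamma>(2 - \<alpha>)\<close> times the truncation error at level \<open>k\<close> is at most
  \<open>d\<^sub>k\<^sub>,\<^sub>1 B\<close>. Since \<open>d\<^sub>k\<^sub>,\<^sub>1 \<ge> (1 - \<alpha>) t\<^sub>k powr (-\<alpha>)\<close>, which is a multiple of
  \<open>(k / M) powr (- r \<alpha>)\<close>, truncation errors of size \<open>k powr (-\<beta>) + h\<^sup>2\<close> with \<open>\<beta> \<le> r \<alpha>\<close> allow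
  \<open>B = C (M powr (-\<beta>) + h\<^sup>2)\<close>.

  For the time truncation error, split the Caputo integral over the mesh intervals. The first
  interval contributes a multiple of \<open>(t\<^sub>1 / t\<^sub>n) powr \<alpha>\<close> because of the bound on the first derivative.
  On an interior interval the first derivative minus the difference quotient has mean zero, so the
  kernel may be replaced by its increment over the interval; these increments telescope for the
  intervals close to \<open>t\<^sub>n\<close> and are controlled by the mean value theorem for the others. On the last
  interval the kernel is integrated directly.
\<close>

section \<open>Elementary estimates\<close>

lemma powr_diff_le_deriv:
  fixes a b r :: real
  assumes "0 \<le> a" "a \<le> b" "1 \<le> r"
  shows "b powr r - a powr r \<le> r * b powr (r - 1) * (b - a)"
proof (cases "a = b")
  case False
  with assms have "a < b" by simp
  then obtain z where z: "a < z" "z < b" "b powr r - a powr r = (b - a) * (r * z powr (r - 1))"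
  proof -
    have "continuous_on {a..b} (\<lambda>x. x powr r)"
      using assms by (intro continuous_intros continuous_on_powr') auto
    moreover have D: "((\<lambda>x. x powr r) has_real_derivative r * x powr (r - 1)) (at x)" if "a < x" for x
      using that assms by (auto intro!: derivative_eq_intros)
    ultimately obtain l z where "a < z" "z < b" "((\<lambda>x. x powr r) has_real_derivative l) (at z)"
      "b powr r - a powr r = (b - a) * l"
      using MVT[of a b "\<lambda>x. x powr r"] \<open>a < b\<close> by (smt (verit) real_differentiable_def)
    then show thesis using that[of z] DERIV_unique[OF _ D] by blast
  qed
  have "z powr (r - 1) \<le> b powr (r - 1)"
    using z assms by (intro powr_mono2) auto
  with z assms show ?thesis
    by (simp add: mult_left_mono mult.commute mult.left_commute)
qed simp

text \<open>The bound is required only inside the interval: by \<open>0 powr a = 0\<close> a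
  singular dominating kernel takes the value 0 at its singular endpoint, where the estimate may
  fail. Changing \<open>g\<close> at the two endpoints leaves its integral unchanged.\<close>

lemma integral_bound_interior:
  fixes f g :: "real \<Rightarrow> real"
  assumes f: "f integrable_on {a..b}" and g: "(g has_integral I) {a..b}"
    and le: "\<And>s. a < s \<Longrightarrow> s < b \<Longrightarrow> \<bar>f s\<bar> \<le> g s"
  shows "\<bar>integral {a..b} f\<bar> \<le> I"
proof -
  define g' where "g' = (\<lambda>s. if s \<in> {a, b} then \<bar>f s\<bar> else g s)"
  have g': "(g' has_integral I) {a..b}"
    by (rule has_integral_spike_finite[OF _ _ g, of "{a, b}"]) (auto simp: g'_def)
  have "norm (integral {a..b} f) \<le> integral {a..b} g'"
    by (rule integral_norm_bound_integral) (use f g' le in \<open>auto simp: g'_def\<close>)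
  with g' show ?thesis by (simp add: integral_unique)
qed

lemma DERIV_powr_kernel:
  fixes \<alpha> s t :: real
  assumes "s < t"
  shows "((\<lambda>s. - ((t - s) powr \<beta>)) has_real_derivative \<beta> * (t - s) powr (\<beta> - 1)) (at s)"
  using assms by (auto intro!: derivative_eq_intros)

text \<open>The singular case \<open>b = t\<close> is included: since 1 - \<alpha> is positive, the
  antiderivative is continuous up to \<open>t\<close>, and its derivative is needed only in the
  interior.\<close>

lemma has_integral_powr_kernel:
  fixes \<alpha> a b t :: real
  assumes "\<alpha> < 1" "a \<le> b" "b \<le> t"
  shows "((\<lambda>s. (t - s) powr (-\<alpha>)) has_integral
          (((t - a) powr (1 - \<alpha>) - (t - b) powr (1 - \<alpha>)) / (1 - \<alpha>))) {a..b}"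
proof -
  have "((\<lambda>s. (t - s) powr (-\<alpha>)) has_integral
          (- ((t - b) powr (1 - \<alpha>)) / (1 - \<alpha>) - - ((t - a) powr (1 - \<alpha>)) / (1 - \<alpha>))) {a..b}"
  proof (rule fundamental_theorem_of_calculus_interior[OF \<open>a \<le> b\<close>])
    show "continuous_on {a..b} (\<lambda>s. - ((t - s) powr (1 - \<alpha>)) / (1 - \<alpha>))"
      using assms by (intro continuous_intros continuous_on_powr') auto
    fix s assume s: "s \<in> {a<..<b}"
    have "((\<lambda>s. - ((t - s) powr (1 - \<alpha>)) / (1 - \<alpha>)) has_real_derivative (t - s) powr (-\<alpha>)) (at s)"
      using DERIV_cdivide[OF DERIV_powr_kernel[of s t "1 - \<alpha>"], of "1 - \<alpha>"] s assms by simp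
    then show "((\<lambda>s. - ((t - s) powr (1 - \<alpha>)) / (1 - \<alpha>)) has_vector_derivative (t - s) powr (-\<alpha>)) (at s)"
      by (simp add: has_real_derivative_iff_has_vector_derivative)
  qed
  then show ?thesis by (simp add: field_simps diff_divide_distrib)
qed

lemma has_integral_powr_left:
  fixes \<alpha> t :: real
  assumes "0 < \<alpha>" "0 \<le> t"
  shows "((\<lambda>s. s powr (\<alpha> - 1)) has_integral (t powr \<alpha> / \<alpha>)) {0..t}"
proof -
  have "((\<lambda>s. s powr (\<alpha> - 1)) has_integral (t powr \<alpha> / \<alpha> - 0 powr \<alpha> / \<alpha>)) {0..t}"
  proof (rule fundamental_theorem_of_calculus_interior[OF \<open>0 \<le> t\<close>])
    show "continuous_on {0..t} (\<lambda>s. s powr \<alpha> / \<alpha>)"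
      using assms by (intro continuous_intros continuous_on_powr') auto
    fix s assume s: "s \<in> {0<..<t}"
    have "((\<lambda>s. s powr \<alpha> / \<alpha>) has_real_derivative s powr (\<alpha> - 1)) (at s)"
      using s assms by (auto intro!: derivative_eq_intros simp: field_simps)
    then show "((\<lambda>s. s powr \<alpha> / \<alpha>) has_vector_derivative s powr (\<alpha> - 1)) (at s)"
      by (simp add: has_real_derivative_iff_has_vector_derivative)
  qed
  then show ?thesis by simp
qed

text \<open>By the mean value theorem \<open>d\<close> equals
  \<open>(1 - \<alpha>) * (t - z) powr (-\<alpha>)\<close> for some \<open>z\<close> between
  \<open>a\<close> and \<open>b\<close>. Two neighbouring weights can thus be compared through the
  kernel at their common mesh point.\<close>

lemma L1_weight_bounds:
  fixes \<alpha> a b t :: real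
  assumes \<alpha>: "0 < \<alpha>" "\<alpha> < 1" and "a < b" "b \<le> t"
  defines "d \<equiv> ((t - a) powr (1 - \<alpha>) - (t - b) powr (1 - \<alpha>)) / (b - a)"
  shows "(1 - \<alpha>) * (t - a) powr (-\<alpha>) \<le> d"
    and "b < t \<Longrightarrow> d \<le> (1 - \<alpha>) * (t - b) powr (-\<alpha>)"
proof -
  have "continuous_on {a..b} (\<lambda>s. - ((t - s) powr (1 - \<alpha>)))"
    using assms by (intro continuous_intros continuous_on_powr') auto
  moreover have D: "((\<lambda>s. - ((t - s) powr (1 - \<alpha>))) has_real_derivative (1 - \<alpha>) * (t - s) powr (-\<alpha>)) (at s)"
    if "s < t" for s
    using DERIV_powr_kernel[OF that, of "1 - \<alpha>"] by simp
  ultimately obtain l z where z: "a < z" "z < b"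
    "((\<lambda>s. - ((t - s) powr (1 - \<alpha>))) has_real_derivative l) (at z)"
    "(t - a) powr (1 - \<alpha>) - (t - b) powr (1 - \<alpha>) = (b - a) * l"
    using MVT[of a b "\<lambda>s. - ((t - s) powr (1 - \<alpha>))"] \<open>a < b\<close> \<open>b \<le> t\<close>
    by (smt (verit) real_differentiable_def)
  have "l = (1 - \<alpha>) * (t - z) powr (-\<alpha>)"
    using DERIV_unique[OF z(3) D] z assms by simp
  with z have d: "d = (1 - \<alpha>) * (t - z) powr (-\<alpha>)"
    using \<open>a < b\<close> by (simp add: d_def)
  show "(1 - \<alpha>) * (t - a) powr (-\<alpha>) \<le> d"
    unfolding d using assms z by (intro mult_left_mono powr_mono2') auto
  show "d \<le> (1 - \<alpha>) * (t - b) powr (-\<alpha>)" if "b < t"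
    unfolding d using assms z that by (intro mult_left_mono powr_mono2') auto
qed

text \<open>On a bounded time interval the summand 1 in the regularity bounds is absorbed into the
  singular power, so that later estimates deal with a single power of \<open>s\<close>.\<close>

lemma one_add_powr_le:
  fixes s T \<gamma> :: real
  assumes "0 < s" "s \<le> T" "\<gamma> \<le> 0"
  shows "1 + s powr \<gamma> \<le> (1 + T powr (-\<gamma>)) * s powr \<gamma>"
proof -
  have "s powr (-\<gamma>) \<le> T powr (-\<gamma>)" using assms by (intro powr_mono2) auto
  then have "s powr (-\<gamma>) * s powr \<gamma> \<le> T powr (-\<gamma>) * s powr \<gamma>"
    by (intro mult_right_mono) auto
  then show ?thesis using assms by (simp add: powr_minus distrib_right)
qed

lemma powr_kernel_increment:
  fixes \<alpha> a b t :: real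
  assumes "0 < \<alpha>" "a < b" "b < t"
  shows "(t - b) powr (-\<alpha>) - (t - a) powr (-\<alpha>) \<le> \<alpha> * (t - b) powr (-\<alpha> - 1) * (b - a)"
proof -
  have "\<exists>z. a < z \<and> z < b \<and> - ((t - b) powr (-\<alpha>)) - - ((t - a) powr (-\<alpha>)) =
      (b - a) * (-\<alpha> * (t - z) powr (-\<alpha> - 1))"
    using assms by (intro MVT2[of a b "\<lambda>s. - ((t - s) powr (-\<alpha>))"] DERIV_powr_kernel) auto
  then obtain z where z: "a < z" "z < b"
    "(t - b) powr (-\<alpha>) - (t - a) powr (-\<alpha>) = (b - a) * (\<alpha> * (t - z) powr (-\<alpha> - 1))"
    by (auto simp: algebra_simps)
  have "(t - z) powr (-\<alpha> - 1) \<le> (t - b) powr (-\<alpha> - 1)"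
    using z assms by (intro powr_mono2') auto
  then have "(b - a) * (\<alpha> * (t - z) powr (-\<alpha> - 1)) \<le> (b - a) * (\<alpha> * (t - b) powr (-\<alpha> - 1))"
    using assms by (intro mult_left_mono) auto
  then show ?thesis using z(3) by (simp add: mult.commute mult.left_commute)
qed

section \<open>Stability of the scheme\<close>

text \<open>This is Abel summation: after it, each \<open>a j\<close> with \<open>0 < j < k\<close>
  carries the nonpositive coefficient \<open>d j - d (Suc j)\<close>, so replacing it by its upper
  bound \<open>B\<close> can only decrease the sum. The induction on \<open>k\<close> does this one
  index at a time.\<close>

lemma weighted_increments_ge:
  fixes d a :: "nat \<Rightarrow> real"
  assumes "1 \<le> k" "0 \<le> d 1" "\<And>j. 1 \<le> j \<Longrightarrow> j < k \<Longrightarrow> d j \<le> d (Suc j)"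
    and "\<And>j. j < k \<Longrightarrow> a j \<le> B"
  shows "d 1 * (B - a 0) + d k * (a k - B) \<le> (\<Sum>j = 1..k. d j * (a j - a (j - 1)))"
  using assms
proof (induction k rule: nat_induct_at_least)
  case base
  then show ?case by (simp add: algebra_simps)
next
  case (Suc k)
  have "d k * (B - a k) \<le> d (Suc k) * (B - a k)"
    using Suc.prems Suc.hyps by (intro mult_right_mono) auto
  moreover have "d 1 * (B - a 0) + d k * (a k - B) \<le> (\<Sum>j = 1..k. d j * (a j - a (j - 1)))"
    using Suc.prems by (intro Suc.IH) auto
  ultimately show ?case by (simp add: algebra_simps)
qed

text \<open>A discrete maximum principle, proved by strong induction on the time level; the
  induction hypothesis supplies the bound \<open>B\<close> on all earlier values in the memory
  sum.\<close>

lemma scheme_stability: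
  fixes d :: "nat \<Rightarrow> nat \<Rightarrow> real" and e R :: "nat \<Rightarrow> nat \<Rightarrow> real"
  assumes "0 < G" "0 < h" "0 \<le> B"
    and d1: "\<And>k. 1 \<le> k \<Longrightarrow> k \<le> M \<Longrightarrow> 0 < d k 1"
    and mono: "\<And>k j. k \<le> M \<Longrightarrow> 1 \<le> j \<Longrightarrow> j < k \<Longrightarrow> d k j \<le> d k (Suc j)"
    and q: "\<And>k. 1 \<le> k \<Longrightarrow> k \<le> M \<Longrightarrow> 0 \<le> q k"
    and init: "\<And>i. i \<le> N \<Longrightarrow> e i 0 = 0"
    and bdry: "\<And>k. k \<le> M \<Longrightarrow> e 0 k = 0 \<and> e N k = 0"
    and eqn: "\<And>i k. 1 \<le> i \<Longrightarrow> i < N \<Longrightarrow> 1 \<le> k \<Longrightarrow> k \<le> M \<Longrightarrow>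
       1 / G * (\<Sum>j = 1..k. d k j * (e i j - e i (j - 1)))
       - (e (i + 1) k - 2 * e i k + e (i - 1) k) / h\<^sup>2 + q k * e i k = R i k"
    and R: "\<And>i k. 1 \<le> i \<Longrightarrow> i < N \<Longrightarrow> 1 \<le> k \<Longrightarrow> k \<le> M \<Longrightarrow> G * \<bar>R i k\<bar> \<le> d k 1 * B"
    and "k \<le> M" "i \<le> N"
  shows "\<bar>e i k\<bar> \<le> B"
  using \<open>k \<le> M\<close> \<open>i \<le> N\<close>
proof (induction k arbitrary: i rule: less_induct)
  case (less k)
  show ?case
  proof (cases "k = 0")
    case True
    then show ?thesis using init less.prems \<open>0 \<le> B\<close> by simp
  next
    case False
    then have k: "1 \<le> k" "k \<le> M" using less.prems by auto
    obtain m where m: "m \<le> N" "\<And>i. i \<le> N \<Longrightarrow> \<bar>e i k\<bar> \<le> \<bar>e m k\<bar>"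
    proof -
      have "\<exists>m\<in>{..N}. \<forall>i\<in>{..N}. \<bar>e i k\<bar> \<le> \<bar>e m k\<bar>"
        using Max_in[of "(\<lambda>i. \<bar>e i k\<bar>) ` {..N}"] Max_ge[of "(\<lambda>i. \<bar>e i k\<bar>) ` {..N}"]
        by fastforce
      then show ?thesis using that by auto
    qed
    have "\<bar>e m k\<bar> \<le> B"
    proof (cases "m = 0 \<or> m = N")
      case True
      then show ?thesis using bdry k \<open>0 \<le> B\<close> by auto
    next
      case False
      then have mN: "1 \<le> m" "m < N" using m by auto
      \<comment> \<open>Multiplying the equation by the sign of \<open>e m k\<close> turns the point
        of largest modulus into a maximum, so positive and negative extrema are treated
        together.\<close>
      define s where "s = sgn (e m k)"
      have s: "\<bar>s\<bar> \<le> 1" "s * e m k = \<bar>e m k\<bar>" "\<And>x. s * x \<le> \<bar>x\<bar>"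
        by (auto simp: s_def sgn_if)
      define S where "S = (\<Sum>j = 1..k. d k j * (s * e m j - s * e m (j - 1)))"
      have S: "S = s * (\<Sum>j = 1..k. d k j * (e m j - e m (j - 1)))"
        unfolding S_def sum_distrib_left by (intro sum.cong) (auto simp: algebra_simps)
      have "s * e (m + 1) k \<le> \<bar>e m k\<bar>" "s * e (m - 1) k \<le> \<bar>e m k\<bar>"
        using m(2)[of "m + 1"] m(2)[of "m - 1"] s(3)[of "e (m + 1) k"] s(3)[of "e (m - 1) k"] mN by linarith+
      then have lap: "s * (e (m + 1) k - 2 * e m k + e (m - 1) k) \<le> 0"
        using s(2) by (simp add: algebra_simps)
      have "1 / G * S - s * (e (m + 1) k - 2 * e m k + e (m - 1) k) / h\<^sup>2 + q k * \<bar>e m k\<bar> = s * R m k"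
        unfolding S s(2)[symmetric] eqn[OF mN k, symmetric] by (simp add: algebra_simps)
      moreover have "s * (e (m + 1) k - 2 * e m k + e (m - 1) k) / h\<^sup>2 \<le> 0"
        using lap by (simp add: divide_nonpos_nonneg)
      moreover have "0 \<le> q k * \<bar>e m k\<bar>" using q k by simp
      ultimately have "S / G \<le> \<bar>R m k\<bar>" using s(3)[of "R m k"] by simp
      then have "S \<le> G * \<bar>R m k\<bar>"
        using \<open>0 < G\<close> by (simp add: field_simps)
      also have "\<dots> \<le> d k 1 * B" using R mN k by blast
      finally have "S \<le> d k 1 * B" .
      moreover have "d k 1 * (B - s * e m 0) + d k k * (s * e m k - B) \<le> S"
        unfolding S_def
      proof (rule weighted_increments_ge[of k "d k" "\<lambda>j. s * e m j" B])
        show "s * e m j \<le> B" if "j < k" for j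
          using less.IH[OF that, of m] s(3)[of "e m j"] that m k by simp
      qed (use k d1[of k] mono in auto)
      \<comment> \<open>The initial error vanishes, so \<open>d k 1 * B\<close> occurs on both sides
        and cancels. Since \<open>d k k\<close> is positive, what remains forces
        \<open>\<bar>e m k\<bar> \<le> B\<close>.\<close>
      ultimately have "d k k * (\<bar>e m k\<bar> - B) \<le> 0"
        using init[of m] m s(2) by (simp add: algebra_simps)
      moreover have "d k 1 \<le> d k k"
      proof -
        have "d k 1 \<le> d k j" if "1 \<le> j" "j \<le> k" for j
          using that
        proof (induction j rule: nat_induct_at_least)
          case (Suc j)
          then show ?case using mono[of k j] k by simp
        qed simp
        then show ?thesis using k by simp
      qed
      ultimately show ?thesis
        using d1[of k] k by (smt (verit) mult_pos_pos)
    qed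
    then show ?thesis using m(2)[OF less.prems(2)] by simp
  qed
qed

section \<open>Spatial truncation error\<close>

lemma nth_deriv_on_has_derivative:
  assumes "times_differentiable_on n g S" "k < n" "x \<in> S"
  shows "(nth_deriv_on S k g has_real_derivative nth_deriv_on S (Suc k) g x) (at x within S)"
  using assms
  by (simp add: times_differentiable_on_def differentiable_on_def vector_derivative_works
      has_real_derivative_iff_has_vector_derivative nth_deriv_on_def)

text \<open>Third-order Taylor expansions at \<open>x\<close> are added for the two neighbours; the
  odd terms cancel. Derivatives are relative to \<open>{0..l}\<close>, so the neighbours may be
  endpoints.\<close>

lemma central_difference_error:
  fixes g :: "real \<Rightarrow> real"
  assumes diff: "times_differentiable_on 4 g {0..l}"
    and bound: "\<And>x. x \<in> {0..l} \<Longrightarrow> \<bar>nth_deriv_on {0..l} 4 g x\<bar> \<le> C"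
    and "0 < h" "0 \<le> x - h" "x + h \<le> l"
  shows "\<bar>(g (x + h) - 2 * g x + g (x - h)) / h\<^sup>2 - nth_deriv_on {0..l} 2 g x\<bar> \<le> C * h\<^sup>2"
proof -
  let ?f = "\<lambda>k. nth_deriv_on {0..l} k g"
  have der: "(?f i has_field_derivative ?f (Suc i) y) (at y within {0..l})"
    if "y \<in> {0..l}" "i \<le> 3" for i y
  proof -
    show ?thesis using nth_deriv_on_has_derivative[OF diff] that by simp
  qed
  \<comment> \<open>The remainder estimate from \<open>field_Taylor\<close> has denominator 3!
    instead of 4!. The two remainders add up to \<open>C * h ^ 4 / 3\<close>, which is then rounded
    up.\<close>
  have T: "\<bar>?f 0 z - (\<Sum>i\<le>3. ?f i x * (z - x) ^ i / fact i)\<bar> \<le> C * \<bar>z - x\<bar> ^ 4 / 6"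
    if "z \<in> {0..l}" for z
    using field_Taylor[of "{0..l}" 3 ?f C x z] der bound that assms
    by (simp add: eval_nat_numeral)
  have f0: "?f 0 = g" by (simp add: nth_deriv_on_def)
  have "\<bar>g (x + h) - (g x + ?f 1 x * h + ?f 2 x * h^2 / 2 + ?f 3 x * h ^ 3 / 6)\<bar> \<le> C * h ^ 4 / 6"
    using T[of "x + h"] assms by (simp add: eval_nat_numeral f0)
  moreover have "\<bar>g (x - h) - (g x - ?f 1 x * h + ?f 2 x * h^2 / 2 - ?f 3 x * h ^ 3 / 6)\<bar> \<le> C * h ^ 4 / 6"
    using T[of "x - h"] assms by (simp add: eval_nat_numeral f0)
  ultimately have "\<bar>(g (x + h) - 2 * g x + g (x - h)) - ?f 2 x * h\<^sup>2\<bar> \<le> C * h ^ 4 / 3"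
    by linarith
  moreover have "0 \<le> C" using order_trans[OF abs_ge_zero bound[of x]] assms by auto
  then have "C * h ^ 4 / 3 \<le> C * h ^ 4" using \<open>0 < h\<close> by simp
  ultimately have *: "\<bar>(g (x + h) - 2 * g x + g (x - h)) - ?f 2 x * h\<^sup>2\<bar> \<le> C * h ^ 4" by linarith
  have "(g (x + h) - 2 * g x + g (x - h)) / h\<^sup>2 - ?f 2 x
     = ((g (x + h) - 2 * g x + g (x - h)) - ?f 2 x * h\<^sup>2) / h\<^sup>2"
    using \<open>0 < h\<close> by (simp add: field_simps)
  then have "\<bar>(g (x + h) - 2 * g x + g (x - h)) / h\<^sup>2 - ?f 2 x\<bar>
     = \<bar>(g (x + h) - 2 * g x + g (x - h)) - ?f 2 x * h\<^sup>2\<bar> / h\<^sup>2" by simp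
  also have "\<dots> \<le> C * h ^ 4 / h\<^sup>2" using * by (intro divide_right_mono) auto
  also have "\<dots> = C * h\<^sup>2" using \<open>0 < h\<close> by (simp add: eval_nat_numeral)
  finally show ?thesis .
qed

section \<open>Error of the L1 formula on one mesh interval\<close>

text \<open>The difference quotient is the value of \<open>y1\<close> at some interior point, so the
  difference is an increment of \<open>y1\<close> over a distance of at most
  \<open>b - a\<close>.\<close>

lemma deriv_minus_slope_bound:
  fixes y y1 y2 :: "real \<Rightarrow> real"
  assumes "a < b" "continuous_on {a..b} y"
    and y1: "\<And>s. a < s \<Longrightarrow> s < b \<Longrightarrow> (y has_real_derivative y1 s) (at s)"
    and y2: "\<And>s. a < s \<Longrightarrow> s < b \<Longrightarrow> (y1 has_real_derivative y2 s) (at s)"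
    and B: "\<And>s. a < s \<Longrightarrow> s < b \<Longrightarrow> \<bar>y2 s\<bar> \<le> B"
    and s: "a < s" "s < b"
  shows "\<bar>y1 s - (y b - y a) / (b - a)\<bar> \<le> B * (b - a)"
proof -
  have "\<exists>l z. a < z \<and> z < b \<and> (y has_real_derivative l) (at z) \<and> y b - y a = (b - a) * l"
    using assms by (intro MVT) (auto simp: real_differentiable_def)
  then obtain l z where z: "a < z" "z < b" "(y has_real_derivative l) (at z)" "y b - y a = (b - a) * l"
    by blast
  have "l = y1 z" using DERIV_unique[OF z(3) y1] z by blast
  with z have slope: "(y b - y a) / (b - a) = y1 z" using \<open>a < b\<close> by simp
  have "norm (y1 s - y1 z) \<le> B * norm (s - z)"
  proof (rule field_differentiable_bound[of "{a<..<b}"])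
    show "(y1 has_field_derivative y2 x) (at x within {a<..<b})" if "x \<in> {a<..<b}" for x
      using y2[of x] that by (auto intro: has_field_derivative_at_within)
  qed (use B z s in auto)
  also have "\<dots> \<le> B * (b - a)"
    using order_trans[OF abs_ge_zero B[OF s]] z s by (intro mult_left_mono) auto
  finally show ?thesis by (simp add: slope)
qed

text \<open>As \<open>y1\<close> minus the slope has mean zero, the kernel may be replaced by its increment.\<close>
lemma interior_interval_error:
  fixes y y1 y2 :: "real \<Rightarrow> real"
  assumes "0 < \<alpha>" "\<alpha> < 1" "a < b" "b < t" and cont: "continuous_on {a..b} y"
    and y1: "\<And>s. a < s \<Longrightarrow> s < b \<Longrightarrow> (y has_real_derivative y1 s) (at s)"
    and y2: "\<And>s. a < s \<Longrightarrow> s < b \<Longrightarrow> (y1 has_real_derivative y2 s) (at s)"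
    and B: "\<And>s. a < s \<Longrightarrow> s < b \<Longrightarrow> \<bar>y2 s\<bar> \<le> B"
  defines "F \<equiv> \<lambda>s. (y1 s - (y b - y a) / (b - a)) * (t - s) powr (-\<alpha>)"
  assumes F: "F integrable_on {a..b}"
  shows "\<bar>integral {a..b} F\<bar> \<le> B * (b - a) * (b - a) * ((t - b) powr (-\<alpha>) - (t - a) powr (-\<alpha>))"
proof -
  let ?c = "(y b - y a) / (b - a)" and ?w = "\<lambda>s. (t - s) powr (-\<alpha>)"
  have "(y1 has_integral (y b - y a)) {a..b}"
    using assms by (intro fundamental_theorem_of_calculus_interior)
      (auto simp: has_real_derivative_iff_has_vector_derivative)
  from has_integral_diff[OF this has_integral_const_real[of ?c a b]]
  have "((\<lambda>s. y1 s - ?c) has_integral 0) {a..b}" using \<open>a < b\<close> by simp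
  from has_integral_mult_left[OF this, of "?w a"]
  have zero: "((\<lambda>s. (y1 s - ?c) * ?w a) has_integral 0) {a..b}" by simp
  let ?G = "\<lambda>s. F s - (y1 s - ?c) * ?w a"
  have G: "(?G has_integral integral {a..b} F - 0) {a..b}"
    using F zero by (intro has_integral_diff) auto
  have "\<bar>integral {a..b} ?G\<bar> \<le> B * (b - a) * (?w b - ?w a) * (b - a)"
  proof (rule integral_bound_interior[where g = "\<lambda>s. B * (b - a) * (?w b - ?w a)"])
    show "((\<lambda>s. B * (b - a) * (?w b - ?w a)) has_integral B * (b - a) * (?w b - ?w a) * (b - a)) {a..b}"
      using has_integral_const_real[of "B * (b - a) * (?w b - ?w a)" a b] \<open>a < b\<close> by (simp add: mult.commute)
    fix s assume s: "a < s" "s < b"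
    have "?w a \<le> ?w s" "?w s \<le> ?w b"
      using s assms by (auto intro!: powr_mono2')
    then have "\<bar>y1 s - ?c\<bar> * \<bar>?w s - ?w a\<bar> \<le> B * (b - a) * (?w b - ?w a)"
      using deriv_minus_slope_bound[of a b y y1 y2 B s] s assms order_trans[OF abs_ge_zero B[OF s]]
      by (intro mult_mono) auto
    then show "\<bar>F s - (y1 s - ?c) * ?w a\<bar> \<le> B * (b - a) * (?w b - ?w a)"
      by (simp add: F_def right_diff_distrib[symmetric] abs_mult)
  qed (use G in auto)
  with G show ?thesis by (simp add: integral_unique mult.assoc mult.commute mult.left_commute)
qed

text \<open>Here the kernel is singular at \<open>b\<close>, so its increment over the interval is
  no longer a usable bound. The kernel itself is integrable and yields the factor
  \<open>(b - a) powr (1 - \<alpha>) / (1 - \<alpha>)\<close>.\<close>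

lemma last_interval_error:
  fixes y y1 y2 :: "real \<Rightarrow> real"
  assumes "0 < \<alpha>" "\<alpha> < 1" "a < b" and cont: "continuous_on {a..b} y"
    and y1: "\<And>s. a < s \<Longrightarrow> s < b \<Longrightarrow> (y has_real_derivative y1 s) (at s)"
    and y2: "\<And>s. a < s \<Longrightarrow> s < b \<Longrightarrow> (y1 has_real_derivative y2 s) (at s)"
    and B: "\<And>s. a < s \<Longrightarrow> s < b \<Longrightarrow> \<bar>y2 s\<bar> \<le> B"
  defines "F \<equiv> \<lambda>s. (y1 s - (y b - y a) / (b - a)) * (b - s) powr (-\<alpha>)"
  assumes F: "F integrable_on {a..b}"
  shows "\<bar>integral {a..b} F\<bar> \<le> B * (b - a) * ((b - a) powr (1 - \<alpha>) / (1 - \<alpha>))"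
proof (rule integral_bound_interior[OF F, where g = "\<lambda>s. B * (b - a) * (b - s) powr (-\<alpha>)"])
  show "((\<lambda>s. B * (b - a) * (b - s) powr (-\<alpha>)) has_integral
     B * (b - a) * ((b - a) powr (1 - \<alpha>) / (1 - \<alpha>))) {a..b}"
    using has_integral_mult_right[OF has_integral_powr_kernel[of \<alpha> a b b], of "B * (b - a)"] assms
    by simp
  fix s assume "a < s" "s < b"
  then show "\<bar>F s\<bar> \<le> B * (b - a) * (b - s) powr (-\<alpha>)"
    using deriv_minus_slope_bound[of a b y y1 y2 B s] assms
    by (auto simp: F_def abs_mult intro!: mult_right_mono)
qed

text \<open>\<open>y1\<close> may blow up at 0, so the slope is bounded through the integral of
  \<open>y1\<close>, whose singularity is integrable.\<close>

lemma initial_slope_bound: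
  fixes y y1 :: "real \<Rightarrow> real"
  assumes "0 < \<alpha>" "0 < a" and cont: "continuous_on {0..a} y"
    and y1: "\<And>s. 0 < s \<Longrightarrow> s < a \<Longrightarrow> (y has_real_derivative y1 s) (at s)"
    and K: "\<And>s. 0 < s \<Longrightarrow> s < a \<Longrightarrow> \<bar>y1 s\<bar> \<le> K * s powr (\<alpha> - 1)"
  shows "\<bar>(y a - y 0) / a\<bar> \<le> K * a powr (\<alpha> - 1) / \<alpha>"
proof -
  have "(y1 has_integral (y a - y 0)) {0..a}"
    using assms by (intro fundamental_theorem_of_calculus_interior)
      (auto simp: has_real_derivative_iff_has_vector_derivative)
  moreover have "((\<lambda>s. K * s powr (\<alpha> - 1)) has_integral K * (a powr \<alpha> / \<alpha>)) {0..a}"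
    using assms by (intro has_integral_mult_right has_integral_powr_left) auto
  ultimately have "\<bar>y a - y 0\<bar> \<le> K * (a powr \<alpha> / \<alpha>)"
    using integral_bound_interior[of y1 0 a, OF _ _ K] by (auto simp: has_integral_iff)
  then have "\<bar>y a - y 0\<bar> / a \<le> K * (a powr \<alpha> / \<alpha>) / a"
    using \<open>0 < a\<close> by (intro divide_right_mono) auto
  then show ?thesis using \<open>0 < a\<close> by (simp add: powr_diff mult.commute)
qed

text \<open>The terms come from the product of the singularity at 0 with the kernel on the left
  half, the same product on the right half, and the slope against the kernel. By scaling, the
  interval length cancels.\<close>

definition first_interval_const :: "real \<Rightarrow> real" where
  "first_interval_const \<alpha> = 2 powr \<alpha> / \<alpha> + 2 powr (1 - \<alpha>) / (1 - \<alpha>) + 1 / (\<alpha> * (1 - \<alpha>))"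

lemma first_interval_error:
  fixes y y1 :: "real \<Rightarrow> real"
  assumes "0 < \<alpha>" "\<alpha> < 1" "0 < a" "a \<le> t" and cont: "continuous_on {0..a} y"
    and y1: "\<And>s. 0 < s \<Longrightarrow> s < a \<Longrightarrow> (y has_real_derivative y1 s) (at s)"
    and K: "\<And>s. 0 < s \<Longrightarrow> s < a \<Longrightarrow> \<bar>y1 s\<bar> \<le> K * s powr (\<alpha> - 1)"
  defines "F \<equiv> \<lambda>s. (y1 s - (y a - y 0) / a) * (t - s) powr (-\<alpha>)"
  assumes F: "F integrable_on {0..a}"
  shows "\<bar>integral {0..a} F\<bar> \<le> first_interval_const \<alpha> * K * (a / t) powr \<alpha>"
proof -
  define g where "g = (\<lambda>s. (a / t) powr \<alpha> * K *
    ((a / 2) powr (-\<alpha>) * s powr (\<alpha> - 1) +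
     ((a / 2) powr (\<alpha> - 1) + a powr (\<alpha> - 1) / \<alpha>) * (a - s) powr (-\<alpha>)))"
  define I where "I = (a / t) powr \<alpha> * K *
    ((a / 2) powr (-\<alpha>) * (a powr \<alpha> / \<alpha>) +
     ((a / 2) powr (\<alpha> - 1) + a powr (\<alpha> - 1) / \<alpha>) * (a powr (1 - \<alpha>) / (1 - \<alpha>)))"
  have "0 \<le> K"
    using order_trans[OF abs_ge_zero K[of "a / 2"]] \<open>0 < a\<close> by (simp add: zero_le_mult_iff)
  have k: "((\<lambda>s. (a - s) powr (-\<alpha>)) has_integral a powr (1 - \<alpha>) / (1 - \<alpha>)) {0..a}"
    using has_integral_powr_kernel[of \<alpha> 0 a a] assms by simp
  have "\<bar>integral {0..a} F\<bar> \<le> I"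
  proof (rule integral_bound_interior[OF F, where g = g])
    show "(g has_integral I) {0..a}"
      unfolding g_def I_def using assms
      by (intro has_integral_mult_right has_integral_add has_integral_powr_left k) auto
    fix s assume s: "0 < s" "s < a"
    \<comment> \<open>This compares the kernel at \<open>t\<close> with the kernel at
      \<open>a\<close> and extracts the decay factor \<open>(a / t) powr \<alpha>\<close>; the rest
      is the case \<open>t = a\<close>.\<close>
    have "t * s \<ge> a * s" using s \<open>a \<le> t\<close> by (intro mult_right_mono) auto
    then have "(t / a) * (a - s) \<le> t - s"
      using assms by (simp add: field_simps)
    then have "(t - s) powr (-\<alpha>) \<le> ((t / a) * (a - s)) powr (-\<alpha>)"
      using s assms by (intro powr_mono2') auto
    also have "\<dots> = (a / t) powr \<alpha> * (a - s) powr (-\<alpha>)"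
      by (simp add: powr_mult powr_divide powr_minus divide_simps)
    finally have ker: "(t - s) powr (-\<alpha>) \<le> (a / t) powr \<alpha> * (a - s) powr (-\<alpha>)" .
    \<comment> \<open>The two singularities sit at opposite ends. On each half only one factor is
      singular and the other is at most its value at \<open>a / 2\<close>; the sum of both bounds
      covers all \<open>s\<close>.\<close>
    have "s powr (\<alpha> - 1) * (a - s) powr (-\<alpha>) \<le>
       (a / 2) powr (-\<alpha>) * s powr (\<alpha> - 1) + (a / 2) powr (\<alpha> - 1) * (a - s) powr (-\<alpha>)"
    proof (cases "s \<le> a / 2")
      case True
      then have "(a - s) powr (-\<alpha>) \<le> (a / 2) powr (-\<alpha>)"
        using s assms by (intro powr_mono2') auto
      then have "s powr (\<alpha> - 1) * (a - s) powr (-\<alpha>) \<le> s powr (\<alpha> - 1) * (a / 2) powr (-\<alpha>)"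
        by (intro mult_left_mono) auto
      then show ?thesis by (simp add: mult.commute add_increasing2)
    next
      case False
      then have "s powr (\<alpha> - 1) \<le> (a / 2) powr (\<alpha> - 1)"
        using s assms by (intro powr_mono2') auto
      then have "s powr (\<alpha> - 1) * (a - s) powr (-\<alpha>) \<le> (a / 2) powr (\<alpha> - 1) * (a - s) powr (-\<alpha>)"
        by (intro mult_right_mono) auto
      then show ?thesis by (simp add: add_increasing)
    qed
    then have prod: "(s powr (\<alpha> - 1) + a powr (\<alpha> - 1) / \<alpha>) * (a - s) powr (-\<alpha>) \<le>
       (a / 2) powr (-\<alpha>) * s powr (\<alpha> - 1) +
        ((a / 2) powr (\<alpha> - 1) + a powr (\<alpha> - 1) / \<alpha>) * (a - s) powr (-\<alpha>)"
      by (simp add: algebra_simps)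
    have "\<bar>y1 s - (y a - y 0) / a\<bar> \<le> K * (s powr (\<alpha> - 1) + a powr (\<alpha> - 1) / \<alpha>)"
    proof -
      have "\<bar>(y a - y 0) / a\<bar> \<le> K * a powr (\<alpha> - 1) / \<alpha>"
        using assms by (intro initial_slope_bound[of \<alpha> a y y1 K]) auto
      then have "\<bar>y1 s - (y a - y 0) / a\<bar> \<le> K * s powr (\<alpha> - 1) + K * a powr (\<alpha> - 1) / \<alpha>"
        using K[OF s] by linarith
      then show ?thesis by (simp add: distrib_left)
    qed
    then have "\<bar>F s\<bar> \<le> K * (s powr (\<alpha> - 1) + a powr (\<alpha> - 1) / \<alpha>) * ((a / t) powr \<alpha> * (a - s) powr (-\<alpha>))"
      unfolding F_def abs_mult using ker by (intro mult_mono) auto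
    also have "\<dots> = (a / t) powr \<alpha> * K * ((s powr (\<alpha> - 1) + a powr (\<alpha> - 1) / \<alpha>) * (a - s) powr (-\<alpha>))"
      by simp
    also have "\<dots> \<le> g s"
      unfolding g_def using prod \<open>0 \<le> K\<close> by (intro mult_left_mono) auto
    finally show "\<bar>F s\<bar> \<le> g s" .
  qed
  also have "I = first_interval_const \<alpha> * K * (a / t) powr \<alpha>"
  proof -
    have "(a / 2) powr (-\<alpha>) * (a powr \<alpha> / \<alpha>) = 2 powr \<alpha> / \<alpha>"
      using \<open>0 < a\<close> by (simp add: powr_divide powr_minus field_simps)
    moreover have "(a / 2) powr (\<alpha> - 1) * (a powr (1 - \<alpha>) / (1 - \<alpha>)) = 2 powr (1 - \<alpha>) / (1 - \<alpha>)"
      using \<open>0 < a\<close> by (simp add: powr_divide powr_diff)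
    moreover have "a powr (\<alpha> - 1) / \<alpha> * (a powr (1 - \<alpha>) / (1 - \<alpha>)) = 1 / (\<alpha> * (1 - \<alpha>))"
      using \<open>0 < a\<close> by (simp add: powr_diff)
    ultimately have "(a / 2) powr (-\<alpha>) * (a powr \<alpha> / \<alpha>) +
     ((a / 2) powr (\<alpha> - 1) + a powr (\<alpha> - 1) / \<alpha>) * (a powr (1 - \<alpha>) / (1 - \<alpha>)) = first_interval_const \<alpha>"
      unfolding first_interval_const_def distrib_right by linarith
    then show ?thesis unfolding I_def by simp
  qed
  finally show ?thesis .
qed

section \<open>Error of the L1 formula on a graded mesh\<close>

text \<open>\<open>A\<close> stands for \<open>T / real M powr r\<close>. The constants defined in
  this locale involve only \<alpha> and \<open>r\<close>, which makes the resulting bounds uniform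
  in \<open>M\<close>.\<close>

locale graded_mesh =
  fixes \<alpha> r A :: real and t :: "nat \<Rightarrow> real"
  assumes \<alpha>: "0 < \<alpha>" "\<alpha> < 1" and r: "1 \<le> r" and A: "0 < A"
    and t_eq: "\<And>j. t j = A * real j powr r"
begin

section \<open>Step sizes and ratios of mesh points\<close>

lemma t_0 [simp]: "t 0 = 0"
  by (simp add: t_eq)

lemma t_pos: "1 \<le> j \<Longrightarrow> 0 < t j"
  using A by (simp add: t_eq)

lemma t_strict_mono: "i < j \<Longrightarrow> t i < t j"
  using A r by (simp add: t_eq powr_less_mono2)

lemma t_mono: "i \<le> j \<Longrightarrow> t i \<le> t j"
  using t_strict_mono[of i j] by (cases "i = j") auto

lemma t_pred_less: "1 \<le> j \<Longrightarrow> t (j - 1) < t j"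
  by (simp add: t_strict_mono)

lemma step_le:
  assumes "1 \<le> j"
  shows "t j - t (j - 1) \<le> r * t j / real j"
proof -
  have "real j powr r - real (j - 1) powr r \<le> r * real j powr (r - 1) * (real j - real (j - 1))"
    using r by (intro powr_diff_le_deriv) auto
  also have "\<dots> = r * real j powr r / real j"
    using assms by (simp add: powr_diff of_nat_diff)
  finally have "A * (real j powr r - real (j - 1) powr r) \<le> A * (r * real j powr r / real j)"
    using A by (intro mult_left_mono) auto
  then show ?thesis by (simp add: t_eq algebra_simps)
qed

lemma step_ge:
  assumes "1 \<le> j"
  shows "t j / real j \<le> t j - t (j - 1)"
proof -
  have "real (j - 1) powr r = real (j - 1) * real (j - 1) powr (r - 1)"
    by (simp add: powr_mult_base)
  also have "\<dots> \<le> real (j - 1) * real j powr (r - 1)"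
    using r by (intro mult_left_mono powr_mono2) auto
  also have "\<dots> = real j powr r - real j powr r / real j"
    using assms by (simp add: powr_diff of_nat_diff field_simps)
  finally have "A * real (j - 1) powr r \<le> A * (real j powr r - real j powr r / real j)"
    using A by (intro mult_left_mono) auto
  then show ?thesis by (simp add: t_eq algebra_simps)
qed

lemma t_ratio: "t j / t n = (real j / real n) powr r"
  using A by (simp add: t_eq powr_divide)

text \<open>Neighbouring mesh points are comparable away from 0, since
  \<open>j \<le> 2 * (j - 1)\<close> for \<open>j \<ge> 2\<close>. This allows a singular power at
  the left end of an interval to be replaced by one at the right end.\<close>

lemma t_le_double:
  assumes "2 \<le> j"
  shows "t j \<le> 2 powr r * t (j - 1)"
proof -
  have "real j powr r \<le> (2 * real (j - 1)) powr r"
    using assms r by (intro powr_mono2) (auto simp: of_nat_diff)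
  then have "A * real j powr r \<le> A * (2 powr r * real (j - 1) powr r)"
    using A by (simp add: powr_mult)
  then show ?thesis by (simp add: t_eq mult.left_commute)
qed

section \<open>Weighted sums of kernel increments\<close>

abbreviation ker :: "nat \<Rightarrow> nat \<Rightarrow> real" where
  "ker n j \<equiv> (t n - t j) powr (-\<alpha>)"

lemma ker_pred_le: "1 \<le> j \<Longrightarrow> j < n \<Longrightarrow> ker n (j - 1) \<le> ker n j"
  using \<alpha> t_pred_less[of j] t_strict_mono[of j n] by (intro powr_mono2') auto

text \<open>The summand 4 accounts for the intervals with \<open>2 * j > n\<close>, the convergent
  series for those with \<open>2 * j \<le> n\<close>.\<close>

definition memory_const :: real where
  "memory_const = 4 + \<alpha> * r * 2 powr (\<alpha> + 1) * (\<Sum>j. real j powr (-1 - \<alpha>))"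

text \<open>As \<open>t j \<le> t n / 2\<close>, the kernel is smooth on this interval with
  derivative of size \<open>t n powr (-\<alpha> - 1)\<close>. Up to constants the term is
  \<open>(j / n) powr (r * (\<alpha> + 1)) * j powr (-3)\<close>. The condition \<beta> \<le> r *
  \<alpha> lowers the first exponent to \<beta>, and \<beta> \<le> 2 - \<alpha> makes the remaining
  power of \<open>j\<close> summable.\<close>

lemma memory_term_early:
  assumes j: "1 \<le> j" "2 * j \<le> n" and \<beta>: "\<beta> \<le> 2 - \<alpha>" "\<beta> \<le> r * \<alpha>"
  shows "t j powr \<alpha> / (real j)\<^sup>2 * (ker n j - ker n (j - 1))
    \<le> \<alpha> * r * 2 powr (\<alpha> + 1) * real n powr (-\<beta>) * real j powr (-1 - \<alpha>)"
proof -
  have n: "1 \<le> n" "j < n" using j by auto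
  have tj: "0 < t j" and tn: "0 < t n" using t_pos j n by auto
  have "(real j / real n) powr r \<le> (1 / 2) powr r"
    using j n r by (intro powr_mono2) (auto simp: field_simps)
  also have "\<dots> \<le> (1 / 2) powr 1"
    using r by (intro powr_mono') auto
  finally have "t j / t n \<le> 1 / 2" by (simp add: t_ratio)
  then have half: "t n / 2 \<le> t n - t j" using tn by (simp add: field_simps)
  have "ker n j - ker n (j - 1) \<le> \<alpha> * (t n - t j) powr (-\<alpha> - 1) * (t j - t (j - 1))"
    using \<alpha> j n by (intro powr_kernel_increment) (auto simp: t_strict_mono)
  also have "\<dots> \<le> \<alpha> * (t n / 2) powr (-\<alpha> - 1) * (r * t j / real j)"
    using \<alpha> half tn j step_le t_pred_less[of j]
    by (intro mult_mono powr_mono2' mult_left_mono) auto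
  finally have "t j powr \<alpha> / (real j)\<^sup>2 * (ker n j - ker n (j - 1))
    \<le> t j powr \<alpha> / (real j)\<^sup>2 * (\<alpha> * (t n / 2) powr (-\<alpha> - 1) * (r * t j / real j))"
    by (intro mult_left_mono) auto
  also have "\<dots> = \<alpha> * r * 2 powr (\<alpha> + 1) * ((t j / t n) powr (\<alpha> + 1) * real j powr (-3))"
  proof -
    have "(t n / 2) powr (-\<alpha> - 1) = 2 powr (\<alpha> + 1) / t n powr (\<alpha> + 1)"
    proof -
      have "(t n / 2) powr (-\<alpha> - 1) = (t n / 2) powr (- (\<alpha> + 1))" by simp
      then show ?thesis by (simp only: powr_minus powr_divide) (simp add: field_simps)
    qed
    moreover have "(t j / t n) powr (\<alpha> + 1) = t j powr \<alpha> * t j / t n powr (\<alpha> + 1)"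
      using tj by (simp add: powr_divide powr_add)
    moreover have "real j powr (-3) = 1 / real j ^ 3"
      using j by (simp add: powr_minus_divide powr_numeral)
    ultimately show ?thesis
      by (simp add: power2_eq_square power3_eq_cube mult.assoc mult.commute mult.left_commute)
  qed
  also have "\<dots> \<le> \<alpha> * r * 2 powr (\<alpha> + 1) * (real n powr (-\<beta>) * real j powr (-1 - \<alpha>))"
  proof (rule mult_left_mono)
    have "(t j / t n) powr (\<alpha> + 1) = (real j / real n) powr (r * (\<alpha> + 1))"
      by (simp add: t_ratio powr_powr)
    also have "\<dots> \<le> (real j / real n) powr \<beta>"
      using \<beta> r n j by (intro powr_mono') (auto simp: algebra_simps)
    finally have "(t j / t n) powr (\<alpha> + 1) * real j powr (-3) \<le> (real j / real n) powr \<beta> * real j powr (-3)"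
      by (intro mult_right_mono) auto
    also have "\<dots> = real n powr (-\<beta>) * real j powr (\<beta> - 3)"
      using j n by (simp add: powr_divide powr_minus powr_diff field_simps)
    also have "\<dots> \<le> real n powr (-\<beta>) * real j powr (-1 - \<alpha>)"
      using \<beta> j by (intro mult_left_mono powr_mono) auto
    finally show "(t j / t n) powr (\<alpha> + 1) * real j powr (-3) \<le> real n powr (-\<beta>) * real j powr (-1 - \<alpha>)" .
  qed (use \<alpha> r in auto)
  finally show ?thesis by (simp only: mult.assoc)
qed

text \<open>The factor \<open>t j powr \<alpha> / (real j)\<^sup>2\<close> is, up to constants, the
  second-derivative bound times the squared step. For \<open>2 * j > n\<close> it is at most
  \<open>4 * t n powr \<alpha> / (real n)\<^sup>2\<close>, while the increments telescope to at most
  \<open>ker n (n - 1)\<close>, which \<open>step_ge\<close> controls; the product is of order n to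
  the power \<alpha> - 2.\<close>

lemma memory_sum:
  assumes n: "2 \<le> n" and \<beta>: "\<beta> \<le> 2 - \<alpha>" "\<beta> \<le> r * \<alpha>"
  shows "(\<Sum>j = 2..n - 1. t j powr \<alpha> / (real j)\<^sup>2 * (ker n j - ker n (j - 1)))
    \<le> memory_const * real n powr (-\<beta>)"
proof -
  define c where "c = \<alpha> * r * 2 powr (\<alpha> + 1) * real n powr (-\<beta>)"
  have c: "0 \<le> c" using \<alpha> r by (simp add: c_def)
  have tn: "0 < t n" using t_pos n by simp
  \<comment> \<open>Each term is bounded by the sum of the early and the late bound, both
    nonnegative. Hence the range need not be split at \<open>n / 2\<close> and the telescoping runs
    over all of it.\<close>
  have "(\<Sum>j = 2..n - 1. t j powr \<alpha> / (real j)\<^sup>2 * (ker n j - ker n (j - 1)))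
     \<le> (\<Sum>j = 2..n - 1. 4 * t n powr \<alpha> / (real n)\<^sup>2 * (ker n j - ker n (j - 1))
          + c * real j powr (-1 - \<alpha>))"
  proof (rule sum_mono)
    fix j assume j: "j \<in> {2..n - 1}"
    then have jn: "1 \<le> j" "j < n" by auto
    have inc: "0 \<le> ker n j - ker n (j - 1)" using ker_pred_le[OF jn] by simp
    show "t j powr \<alpha> / (real j)\<^sup>2 * (ker n j - ker n (j - 1))
       \<le> 4 * t n powr \<alpha> / (real n)\<^sup>2 * (ker n j - ker n (j - 1)) + c * real j powr (-1 - \<alpha>)"
    proof (cases "2 * j \<le> n")
      case True
      then show ?thesis
        using memory_term_early[of j n \<beta>] jn \<beta> inc by (simp add: c_def add_increasing)
    next
      case False
      have "t j powr \<alpha> \<le> t n powr \<alpha>"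
        using \<alpha> t_pos[of j] t_mono[of j n] jn by (intro powr_mono2) auto
      moreover have "(real n)\<^sup>2 \<le> (2 * real j)\<^sup>2"
        using False by (intro power_mono) auto
      then have "1 / (real j)\<^sup>2 \<le> 4 / (real n)\<^sup>2"
        using jn by (simp add: field_simps power2_eq_square)
      ultimately have "t j powr \<alpha> * (1 / (real j)\<^sup>2) \<le> t n powr \<alpha> * (4 / (real n)\<^sup>2)"
        by (intro mult_mono) auto
      then have "t j powr \<alpha> / (real j)\<^sup>2 * (ker n j - ker n (j - 1))
         \<le> 4 * t n powr \<alpha> / (real n)\<^sup>2 * (ker n j - ker n (j - 1))"
        using inc by (intro mult_right_mono) (auto simp: mult.commute)
      then show ?thesis using c by (simp add: add_increasing2)
    qed
  qed
  also have "\<dots> = 4 * t n powr \<alpha> / (real n)\<^sup>2 * (\<Sum>j = 2..n - 1. ker n j - ker n (j - 1))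
      + c * (\<Sum>j = 2..n - 1. real j powr (-1 - \<alpha>))"
    by (simp add: sum.distrib sum_distrib_left)
  also have "\<dots> \<le> 4 * real n powr (-\<beta>) + c * (\<Sum>j. real j powr (-1 - \<alpha>))"
  proof (rule add_mono)
    have "(\<Sum>j = Suc 1..n - 1. ker n j - ker n (j - 1)) = ker n (n - 1) - ker n 1"
      using n by (intro sum_telescope'') auto
    then have "(\<Sum>j = 2..n - 1. ker n j - ker n (j - 1)) \<le> ker n (n - 1)"
      by (simp add: numeral_2_eq_2)
    also have "\<dots> \<le> (t n / real n) powr (-\<alpha>)"
      using \<alpha> tn n step_ge[of n] by (intro powr_mono2') auto
    finally have "4 * t n powr \<alpha> / (real n)\<^sup>2 * (\<Sum>j = 2..n - 1. ker n j - ker n (j - 1))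
       \<le> 4 * t n powr \<alpha> / (real n)\<^sup>2 * (t n / real n) powr (-\<alpha>)"
      by (intro mult_left_mono) auto
    also have "\<dots> = 4 * real n powr (\<alpha> - 2)"
      using tn n by (simp add: powr_divide powr_minus powr_diff powr_numeral)
    also have "\<dots> \<le> 4 * real n powr (-\<beta>)"
      using \<beta> n by (intro mult_left_mono powr_mono) auto
    finally show "4 * t n powr \<alpha> / (real n)\<^sup>2 * (\<Sum>j = 2..n - 1. ker n j - ker n (j - 1))
       \<le> 4 * real n powr (-\<beta>)" .
    have "summable (\<lambda>j. real j powr (-1 - \<alpha>))"
      using \<alpha> by (simp add: summable_real_powr_iff)
    then show "c * (\<Sum>j = 2..n - 1. real j powr (-1 - \<alpha>)) \<le> c * (\<Sum>j. real j powr (-1 - \<alpha>))"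
      using c by (intro mult_left_mono sum_le_suminf) auto
  qed
  also have "\<dots> = memory_const * real n powr (-\<beta>)"
    by (simp add: memory_const_def c_def algebra_simps)
  finally show ?thesis .
qed

section \<open>Truncation error summed over all mesh intervals\<close>

lemma curvature_step_bound:
  assumes "2 \<le> j" "0 \<le> K"
  shows "K * t (j - 1) powr (\<alpha> - 2) * (t j - t (j - 1))
     \<le> K * r * 2 powr (r * (2 - \<alpha>)) * (t j powr (\<alpha> - 1) / real j)"
proof -
  have tj: "0 < t j" using t_pos assms by simp
  have "t j * 2 powr (-r) \<le> t (j - 1)"
    using t_le_double[OF assms(1)] by (simp add: powr_minus field_simps)
  then have "t (j - 1) powr (\<alpha> - 2) \<le> (t j * 2 powr (-r)) powr (\<alpha> - 2)"
    using \<alpha> tj by (intro powr_mono2') auto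
  also have "\<dots> = t j powr (\<alpha> - 2) * 2 powr (r * (2 - \<alpha>))"
    by (simp add: powr_mult powr_powr algebra_simps)
  finally have "K * t (j - 1) powr (\<alpha> - 2) * (t j - t (j - 1))
     \<le> K * (t j powr (\<alpha> - 2) * 2 powr (r * (2 - \<alpha>))) * (r * t j / real j)"
    using assms step_le[of j] t_pred_less[of j] by (intro mult_mono mult_left_mono) auto
  also have "t j powr (\<alpha> - 2) = t j powr (\<alpha> - 1) / t j"
    using tj by (simp add: powr_diff powr_numeral power2_eq_square)
  finally show ?thesis using tj by (simp add: mult.assoc mult.commute mult.left_commute)
qed

text \<open>The three contributions belong to the first interval, the interior intervals (with
  \<open>memory_const\<close>) and the last interval.\<close>

definition truncation_const :: real where
  "truncation_const = first_interval_const \<alpha> +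
     r * 2 powr (r * (2 - \<alpha>)) * (r * memory_const + r powr (1 - \<alpha>) / (1 - \<alpha>))"

lemma truncation_error:
  fixes y y1 y2 :: "real \<Rightarrow> real"
  assumes n: "1 \<le> n" and \<beta>: "\<beta> \<le> 2 - \<alpha>" "\<beta> \<le> r * \<alpha>"
    and cont: "continuous_on {0..t n} y"
    and y1: "\<And>s. 0 < s \<Longrightarrow> s < t n \<Longrightarrow> (y has_real_derivative y1 s) (at s)"
    and y2: "\<And>s. 0 < s \<Longrightarrow> s < t n \<Longrightarrow> (y1 has_real_derivative y2 s) (at s)"
    and K1: "\<And>s. 0 < s \<Longrightarrow> s < t n \<Longrightarrow> \<bar>y1 s\<bar> \<le> K * s powr (\<alpha> - 1)"
    and K2: "\<And>s. 0 < s \<Longrightarrow> s < t n \<Longrightarrow> \<bar>y2 s\<bar> \<le> K * s powr (\<alpha> - 2)"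
    and int: "(\<lambda>s. y1 s * (t n - s) powr (-\<alpha>)) integrable_on {0..t n}"
  defines "d \<equiv> \<lambda>j. ((t n - t (j - 1)) powr (1 - \<alpha>) - (t n - t j) powr (1 - \<alpha>)) / (t j - t (j - 1))"
  shows "\<bar>(\<Sum>j = 1..n. d j * (y (t j) - y (t (j - 1)))) / (1 - \<alpha>)
      - integral {0..t n} (\<lambda>s. y1 s * (t n - s) powr (-\<alpha>))\<bar>
    \<le> truncation_const * K * real n powr (-\<beta>)"
proof -
  let ?w = "\<lambda>s. (t n - s) powr (-\<alpha>)" and ?I = "\<lambda>j. {t (j - 1)..t j}"
  define c where "c = (\<lambda>j. (y (t j) - y (t (j - 1))) / (t j - t (j - 1)))"
  define F where "F = (\<lambda>j s. (y1 s - c j) * ?w s)"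
  define E where "E = (\<lambda>j. integral (?I j) (F j))"
  have tn: "0 < t n" using t_pos n by simp
  have "0 \<le> K * (t n / 2) powr (\<alpha> - 1)"
    using order_trans[OF abs_ge_zero K1[of "t n / 2"]] tn by simp
  then have K: "0 \<le> K" using tn by (simp add: zero_le_mult_iff)
  have intI: "(\<lambda>s. y1 s * ?w s) integrable_on {t i..t j}" if "i \<le> j" "j \<le> n" for i j
    using that t_mono[of 0 i] t_mono[of j n]
    by (intro integrable_on_subinterval[OF int]) auto
  \<comment> \<open>Integrating the constant slope \<open>c j\<close> against the kernel reproduces
    exactly the \<open>j\<close>-th term of the L1 formula, so the \<open>E j\<close> add up to
    minus the truncation error.\<close>
  have F: "(F j has_integral integral (?I j) (\<lambda>s. y1 s * ?w s) -
      d j * (y (t j) - y (t (j - 1))) / (1 - \<alpha>)) (?I j)" if j: "1 \<le> j" "j \<le> n" for j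
  proof -
    have w: "((\<lambda>s. c j * ?w s) has_integral
       c j * (((t n - t (j - 1)) powr (1 - \<alpha>) - (t n - t j) powr (1 - \<alpha>)) / (1 - \<alpha>))) (?I j)"
      using j \<alpha> t_mono[of "j - 1" j] t_mono[of j n]
      by (intro has_integral_mult_right has_integral_powr_kernel) auto
    have eq: "c j * (((t n - t (j - 1)) powr (1 - \<alpha>) - (t n - t j) powr (1 - \<alpha>)) / (1 - \<alpha>))
      = d j * (y (t j) - y (t (j - 1))) / (1 - \<alpha>)"
      by (simp add: c_def d_def)
    have y: "((\<lambda>s. y1 s * ?w s) has_integral integral (?I j) (\<lambda>s. y1 s * ?w s)) (?I j)"
      using intI[of "j - 1" j] j by (simp add: integrable_integral)
    show ?thesis
      using has_integral_diff[OF y w] by (simp only: F_def left_diff_distrib eq)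
  qed
  have intF: "(\<lambda>s. (y1 s - (y (t j) - y (t (j - 1))) / (t j - t (j - 1))) * ?w s) integrable_on ?I j"
    if "1 \<le> j" "j \<le> n" for j
    using F[OF that] unfolding F_def c_def by (rule has_integral_integrable)
  have combine: "(\<Sum>j = 1..m. integral (?I j) (\<lambda>s. y1 s * ?w s)) = integral {0..t m} (\<lambda>s. y1 s * ?w s)"
    if "m \<le> n" for m
    using that
  proof (induction m)
    case (Suc m)
    have "integral {0..t m} (\<lambda>s. y1 s * ?w s) + integral {t m..t (Suc m)} (\<lambda>s. y1 s * ?w s)
       = integral {0..t (Suc m)} (\<lambda>s. y1 s * ?w s)"
      using Suc.prems t_mono[of 0 m] t_mono[of m "Suc m"] intI[of 0 "Suc m"]
      by (intro Henstock_Kurzweil_Integration.integral_combine) auto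
    with Suc show ?case by simp
  qed simp
  have "(\<Sum>j = 1..n. E j) = (\<Sum>j = 1..n. integral (?I j) (\<lambda>s. y1 s * ?w s) -
      d j * (y (t j) - y (t (j - 1))) / (1 - \<alpha>))"
    unfolding E_def using F by (intro sum.cong) (auto simp: integral_unique)
  also have "\<dots> = integral {0..t n} (\<lambda>s. y1 s * ?w s)
      - (\<Sum>j = 1..n. d j * (y (t j) - y (t (j - 1)))) / (1 - \<alpha>)"
    by (simp only: sum_subtractf combine[OF order_refl] sum_divide_distrib[symmetric])
  finally have err: "(\<Sum>j = 1..n. d j * (y (t j) - y (t (j - 1)))) / (1 - \<alpha>)
      - integral {0..t n} (\<lambda>s. y1 s * ?w s) = - (\<Sum>j = 1..n. E j)" by simp

  have sub: "t (j - 1) \<ge> 0" "t j \<le> t n" if "j \<le> n" for j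
    using that t_mono[of 0 "j - 1"] t_mono[of j n] by auto
  have contI: "continuous_on (?I j) y" if "j \<le> n" for j
    using sub[OF that] by (intro continuous_on_subset[OF cont]) auto
  \<comment> \<open>From the second interval on the left endpoint is positive, so the singular bound
    on \<open>y2\<close> is finite and largest there.\<close>
  have B: "\<bar>y2 s\<bar> \<le> K * t (j - 1) powr (\<alpha> - 2)" if "2 \<le> j" "j \<le> n" "t (j - 1) < s" "s < t j" for j s
  proof -
    have "0 < t (j - 1)" using t_pos[of "j - 1"] that by simp
    then have "\<bar>y2 s\<bar> \<le> K * s powr (\<alpha> - 2)" using that sub[of j] by (intro K2) auto
    also have "\<dots> \<le> K * t (j - 1) powr (\<alpha> - 2)"
      using \<open>0 < t (j - 1)\<close> that K \<alpha> by (intro mult_left_mono powr_mono2') auto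
    finally show ?thesis .
  qed
  define Q where "Q = K * r * 2 powr (r * (2 - \<alpha>))"
  have Q: "0 \<le> Q" using K r by (simp add: Q_def)

  have curv: "K * t (j - 1) powr (\<alpha> - 2) * (t j - t (j - 1)) \<le> Q * (t j powr (\<alpha> - 1) / real j)"
    if "2 \<le> j" for j
    using curvature_step_bound[OF that K] by (simp add: Q_def)

  have first: "\<bar>E 1\<bar> \<le> first_interval_const \<alpha> * K * real n powr (-\<beta>)"
  proof -
    have "\<bar>E 1\<bar> \<le> first_interval_const \<alpha> * K * (t 1 / t n) powr \<alpha>"
      using first_interval_error[of \<alpha> "t 1" "t n" y y1 K] \<alpha> t_pos[of 1] sub[of 1] contI[of 1] n intF[of 1] y1 K1
      by (simp add: E_def F_def c_def)
    \<comment> \<open>This is the source of the rate r * \<alpha>; the last interval and the late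
      interior ones produce 2 - \<alpha>.\<close>
    also have "(t 1 / t n) powr \<alpha> = real n powr (- (r * \<alpha>))"
      using n by (simp add: t_ratio powr_powr powr_divide powr_minus divide_simps)
    also have "\<dots> \<le> real n powr (-\<beta>)"
      using \<beta> n by (intro powr_mono) auto
    finally show ?thesis
      using K \<alpha> by (simp add: mult_left_mono first_interval_const_def)
  qed
  have middle: "\<bar>E j\<bar> \<le> Q * r * (t j powr \<alpha> / (real j)\<^sup>2 * (ker n j - ker n (j - 1)))"
    if j: "2 \<le> j" "j < n" for j
  proof -
    have tj: "0 < t (j - 1)" "t (j - 1) < t j" "t j < t n"
      using t_pos[of "j - 1"] t_pred_less[of j] t_strict_mono[of j n] j by auto
    have inc: "0 \<le> ker n j - ker n (j - 1)" using ker_pred_le[of j n] j by simp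
    have "\<bar>E j\<bar> \<le> K * t (j - 1) powr (\<alpha> - 2) * (t j - t (j - 1)) * (t j - t (j - 1)) * (ker n j - ker n (j - 1))"
      unfolding E_def F_def c_def
    proof (rule interior_interval_error[where ?y2.0 = y2])
      fix s assume s: "t (j - 1) < s" "s < t j"
      show "(y has_real_derivative y1 s) (at s)" "(y1 has_real_derivative y2 s) (at s)"
        using s tj by (auto intro!: y1 y2)
      show "\<bar>y2 s\<bar> \<le> K * t (j - 1) powr (\<alpha> - 2)" using B s j by simp
    qed (use \<alpha> j tj contI[of j] intF[of j] in simp_all)
    also have "\<dots> \<le> Q * (t j powr (\<alpha> - 1) / real j) * (r * t j / real j) * (ker n j - ker n (j - 1))"
      using j K Q inc r tj
      by (intro mult_right_mono mult_mono[OF curv step_le]) auto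
    also have "\<dots> = Q * r * (t j powr \<alpha> / (real j)\<^sup>2 * (ker n j - ker n (j - 1)))"
      using tj by (simp add: powr_diff power2_eq_square)
    finally show ?thesis .
  qed
  have last: "\<bar>E n\<bar> \<le> Q * (r powr (1 - \<alpha>) / (1 - \<alpha>)) * real n powr (-\<beta>)" if n2: "2 \<le> n"
  proof -
    have tj: "0 < t (n - 1)" "t (n - 1) < t n"
      using t_pos[of "n - 1"] t_pred_less[of n] n2 by auto
    have "\<bar>E n\<bar> \<le> K * t (n - 1) powr (\<alpha> - 2) * (t n - t (n - 1)) * ((t n - t (n - 1)) powr (1 - \<alpha>) / (1 - \<alpha>))"
      unfolding E_def F_def c_def
    proof (rule last_interval_error[where ?y2.0 = y2])
      fix s assume s: "t (n - 1) < s" "s < t n"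
      show "(y has_real_derivative y1 s) (at s)" "(y1 has_real_derivative y2 s) (at s)"
        using s tj by (auto intro!: y1 y2)
      show "\<bar>y2 s\<bar> \<le> K * t (n - 1) powr (\<alpha> - 2)" using B s n2 by simp
    qed (use \<alpha> n2 tj contI[of n] intF[of n] in simp_all)
    also have "\<dots> \<le> Q * (t n powr (\<alpha> - 1) / real n) * ((r * t n / real n) powr (1 - \<alpha>) / (1 - \<alpha>))"
      using n2 K Q r tj \<alpha> step_le[of n]
      by (intro mult_mono[OF curv] divide_right_mono powr_mono2) auto
    also have "\<dots> = Q * (r powr (1 - \<alpha>) / (1 - \<alpha>)) * real n powr (\<alpha> - 2)"
      using tj tn r n2 by (simp add: powr_mult powr_divide powr_diff powr_numeral power2_eq_square mult.assoc mult.commute mult.left_commute)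
    also have "\<dots> \<le> Q * (r powr (1 - \<alpha>) / (1 - \<alpha>)) * real n powr (-\<beta>)"
      using \<beta> n Q \<alpha> by (intro mult_left_mono powr_mono) auto
    finally show ?thesis .
  qed
  have mem0: "0 \<le> memory_const"
    unfolding memory_const_def using \<alpha> r
    by (intro add_nonneg_nonneg mult_nonneg_nonneg suminf_nonneg) (auto simp: summable_real_powr_iff)
  have "\<bar>\<Sum>j = 1..n. E j\<bar> \<le> truncation_const * K * real n powr (-\<beta>)"
  proof (cases "n = 1")
    case True
    \<comment> \<open>For \<open>n = 1\<close> only the first interval exists, and the other
      summands of \<open>truncation_const\<close> are dropped by sign.\<close>
    have "0 \<le> Q * (r * memory_const + r powr (1 - \<alpha>) / (1 - \<alpha>)) * real n powr (-\<beta>)"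
      using Q r mem0 \<alpha> by simp
    then show ?thesis
      using first True by (simp add: truncation_const_def Q_def algebra_simps)
  next
    case False
    then have n2: "2 \<le> n" using n by simp
    have "{1..n} = insert 1 (insert n {2..n - 1})" using n2 by auto
    then have "(\<Sum>j = 1..n. E j) = E 1 + (E n + (\<Sum>j = 2..n - 1. E j))"
      using n2 by auto
    moreover have "\<bar>\<Sum>j = 2..n - 1. E j\<bar> \<le> Q * r * (memory_const * real n powr (-\<beta>))"
    proof -
      have "\<bar>\<Sum>j = 2..n - 1. E j\<bar> \<le>
         (\<Sum>j = 2..n - 1. Q * r * (t j powr \<alpha> / (real j)\<^sup>2 * (ker n j - ker n (j - 1))))"
        by (intro order_trans[OF sum_abs] sum_mono middle) auto
      also have "\<dots> = Q * r * (\<Sum>j = 2..n - 1. t j powr \<alpha> / (real j)\<^sup>2 * (ker n j - ker n (j - 1)))"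
        by (simp add: sum_distrib_left)
      also have "\<dots> \<le> Q * r * (memory_const * real n powr (-\<beta>))"
        using Q r by (intro mult_left_mono memory_sum n2 \<beta>) auto
      finally show ?thesis .
    qed
    ultimately have "\<bar>\<Sum>j = 1..n. E j\<bar> \<le> first_interval_const \<alpha> * K * real n powr (-\<beta>)
       + (Q * (r powr (1 - \<alpha>) / (1 - \<alpha>)) * real n powr (-\<beta>) + Q * r * (memory_const * real n powr (-\<beta>)))"
      using first last[OF n2] by linarith
    also have "\<dots> = truncation_const * K * real n powr (-\<beta>)"
      by (simp add: truncation_const_def Q_def distrib_left distrib_right)
    finally show ?thesis .
  qed
  then show ?thesis unfolding err by simp
qed

end

section \<open>The mesh of the scheme and the Caputo derivative\<close>

lemma graded_mesh_mesh_time: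
  assumes "0 < \<alpha>" "\<alpha> < 1" "1 \<le> r" "0 < T" "1 \<le> M"
  shows "graded_mesh \<alpha> r (T / real M powr r) (mesh_time T r M)"
  using assms by unfold_locales (auto simp: mesh_time_def powr_divide)

lemma mesh_time_bounds:
  assumes "1 \<le> r" "0 < T" "k \<le> M"
  shows "0 \<le> mesh_time T r M k" "mesh_time T r M k \<le> T"
proof -
  have "(real k / real M) powr r \<le> 1"
    using assms by (intro powr_le1) (auto simp: divide_le_eq_1)
  then show "mesh_time T r M k \<le> T"
    using assms by (simp add: mesh_time_def)
qed (use assms in \<open>simp add: mesh_time_def\<close>)

text \<open>Passes from the Lebesgue integral over the open interval to the gauge integral over the
  closed one. Integrability comes from \<open>caputo_exists_on\<close>, and \<open>0 < t\<close>
  avoids the limit branch of \<open>caputo\<close>.\<close>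

lemma caputo_eq_integral:
  assumes ex: "caputo_exists_on \<alpha> y T" and t: "0 < t" "t \<le> T"
    and y1: "\<And>s. 0 < s \<Longrightarrow> s < t \<Longrightarrow> (y has_real_derivative y1 s) (at s)"
  shows "(\<lambda>s. y1 s * (t - s) powr (-\<alpha>)) integrable_on {0..t}"
    and "caputo \<alpha> y t = integral {0..t} (\<lambda>s. y1 s * (t - s) powr (-\<alpha>)) / Gamma (1 - \<alpha>)"
proof -
  let ?f = "\<lambda>s. deriv y s / (t - s) powr \<alpha>" and ?g = "\<lambda>s. y1 s * (t - s) powr (-\<alpha>)"
  have fg: "?f s = ?g s" if "s \<in> {0<..<t}" for s
    using DERIV_imp_deriv[OF y1] that by (simp add: powr_minus divide_inverse)
  have "set_integrable lebesgue {0<..<t} ?f"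
    using ex t by (auto simp: caputo_exists_on_def)
  note f = set_lebesgue_integral_eq_integral[OF this]
  have "(?g has_integral integral {0<..<t} ?f) {0<..<t}"
    using has_integral_eq[of "{0<..<t}" ?f ?g] fg integrable_integral[OF f(1)] by blast
  then have g: "(?g has_integral integral {0<..<t} ?f) {0..t}"
    using has_integral_open_interval[of ?g _ 0 t] by (simp add: box_real)
  then show "?g integrable_on {0..t}" by blast
  show "caputo \<alpha> y t = integral {0..t} ?g / Gamma (1 - \<alpha>)"
    using g f(2) t by (simp add: caputo_def caputo_integral_def integral_unique)
qed

text \<open>The bracket combines the factors from \<open>one_add_powr_le\<close> for derivative
  orders 1 and 2, so one constant serves both derivatives.\<close>

definition L1_truncation_const :: "real \<Rightarrow> real \<Rightarrow> real \<Rightarrow> real \<Rightarrow> real" where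
  "L1_truncation_const \<alpha> T r C =
     graded_mesh.truncation_const \<alpha> r * (C * (1 + T powr (1 - \<alpha>) + T powr (2 - \<alpha>))) / Gamma (1 - \<alpha>)"

lemma L1_truncation_error:
  fixes y :: "real \<Rightarrow> real"
  assumes \<alpha>: "0 < \<alpha>" "\<alpha> < 1" and r: "1 \<le> r" and T: "0 < T" and n: "1 \<le> n" "n \<le> M"
    and cont: "continuous_on {0..T} y" and ex: "caputo_exists_on \<alpha> y T"
    and diff: "times_differentiable_on 2 y {0<..T}"
    and bound: "\<And>s m. s \<in> {0<..T} \<Longrightarrow> m \<in> {0..2} \<Longrightarrow>
      \<bar>nth_deriv_on {0<..T} m y s\<bar> \<le> C * (1 + s powr (\<alpha> - real m))"
  defines "t \<equiv> mesh_time T r M"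
  shows "\<bar>1 / Gamma (2 - \<alpha>) * (\<Sum>j = 1..n. L1_weight \<alpha> T r M n j * (y (t j) - y (t (j - 1))))
      - caputo \<alpha> y (t n)\<bar>
    \<le> L1_truncation_const \<alpha> T r C * real n powr (- min (2 - \<alpha>) (r * \<alpha>))"
proof -
  interpret graded_mesh \<alpha> r "T / real M powr r" t
    unfolding t_def using assms by (intro graded_mesh_mesh_time) auto
  let ?y1 = "nth_deriv_on {0<..T} 1 y" and ?y2 = "nth_deriv_on {0<..T} 2 y"
  define K where "K = C * (1 + T powr (1 - \<alpha>) + T powr (2 - \<alpha>))"
  have tn: "0 < t n" "t n \<le> T"
    using t_pos[of n] mesh_time_bounds[of r T n M] assms by (auto simp: t_def)
  have C: "0 \<le> C"
  proof -
    have "0 \<le> C * (1 + T powr \<alpha>)"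
      using order_trans[OF abs_ge_zero bound[of T 0]] T by simp
    moreover have "0 < 1 + T powr \<alpha>" using T by (intro add_pos_nonneg) auto
    ultimately show ?thesis by (simp add: zero_le_mult_iff)
  qed
  \<comment> \<open>Points below \<open>t n\<close> are interior to \<open>{0<..T}\<close>, so the
    relative derivatives there are ordinary ones.\<close>
  have "at s within {0<..T} = at s" if "0 < s" "s < t n" for s
    using that tn by (intro at_within_open_subset[of _ "{0<..<t n}"]) auto
  then have D: "(y has_real_derivative ?y1 s) (at s)" "(?y1 has_real_derivative ?y2 s) (at s)"
    if "0 < s" "s < t n" for s
    using nth_deriv_on_has_derivative[OF diff, of 0 s] nth_deriv_on_has_derivative[OF diff, of 1 s]
      that tn by (simp_all add: numeral_2_eq_2 nth_deriv_on_def)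
  have "\<bar>?y1 s\<bar> \<le> K * s powr (\<alpha> - 1)" "\<bar>?y2 s\<bar> \<le> K * s powr (\<alpha> - 2)"
    if s: "0 < s" "s < t n" for s
  proof -
    have "\<bar>nth_deriv_on {0<..T} m y s\<bar> \<le> K * s powr (\<alpha> - real m)" if m: "m \<in> {1, 2}" for m
    proof -
      have "\<bar>nth_deriv_on {0<..T} m y s\<bar> \<le> C * (1 + s powr (\<alpha> - real m))"
        using m s tn by (intro bound) auto
      also have "\<dots> \<le> C * ((1 + T powr (- (\<alpha> - real m))) * s powr (\<alpha> - real m))"
        using C \<alpha> m s tn by (intro mult_left_mono one_add_powr_le) auto
      also have "\<dots> \<le> K * s powr (\<alpha> - real m)"
        unfolding K_def mult.assoc using C m by (intro mult_left_mono mult_right_mono) auto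
      finally show ?thesis .
    qed
    from this[of 1] this[of 2] show "\<bar>?y1 s\<bar> \<le> K * s powr (\<alpha> - 1)" "\<bar>?y2 s\<bar> \<le> K * s powr (\<alpha> - 2)"
      by simp_all
  qed
  note K = this
  note cap = caputo_eq_integral[OF ex tn D(1)]
  let ?S = "\<Sum>j = 1..n. L1_weight \<alpha> T r M n j * (y (t j) - y (t (j - 1)))"
  let ?I = "integral {0..t n} (\<lambda>s. ?y1 s * (t n - s) powr (-\<alpha>))"
  have "continuous_on {0..t n} y"
    using tn by (intro continuous_on_subset[OF cont]) auto
  then have "\<bar>?S / (1 - \<alpha>) - ?I\<bar> \<le> truncation_const * K * real n powr (- min (2 - \<alpha>) (r * \<alpha>))"
    using truncation_error[of n "min (2 - \<alpha>) (r * \<alpha>)" y ?y1 ?y2 K] n D K cap(1)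
    by (simp add: L1_weight_def t_def)
  moreover have G: "0 < Gamma (1 - \<alpha>)" using \<alpha> by (intro Gamma_real_pos) auto
  ultimately have "\<bar>?S / (1 - \<alpha>) - ?I\<bar> / Gamma (1 - \<alpha>) \<le>
      truncation_const * K * real n powr (- min (2 - \<alpha>) (r * \<alpha>)) / Gamma (1 - \<alpha>)"
    by (intro divide_right_mono) auto
  moreover have "Gamma (2 - \<alpha>) = (1 - \<alpha>) * Gamma (1 - \<alpha>)"
    using Gamma_plus1[of "1 - \<alpha>"] nonpos_Ints_nonpos[of "1 - \<alpha>"] \<alpha> by auto
  then have "1 / Gamma (2 - \<alpha>) * ?S - caputo \<alpha> y (t n) = (?S / (1 - \<alpha>) - ?I) / Gamma (1 - \<alpha>)"
    using G \<alpha> by (simp add: cap(2) diff_divide_distrib)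
  ultimately show ?thesis
    using G by (simp add: L1_truncation_const_def K_def)
qed

section \<open>Convergence\<close>

theorem theorem4p2:
  fixes \<alpha> l T r C\<^sub>u :: real
    and p \<phi> :: "real \<Rightarrow> real"
    and f u :: "real \<Rightarrow> real \<Rightarrow> real"
  assumes "0 < \<alpha>" and "\<alpha> < 1" and "0 < l" and "0 < T" and "1 \<le> r"
    and "continuous_on {0..T} p" and "\<And>t. t \<in> {0..T} \<Longrightarrow> 0 \<le> p t"
    and "\<phi> \<in> sobolev_H 2 0 l \<inter> sobolev_H10 0 l"
    and "continuous_on ({0..l} \<times> {0..T}) (\<lambda>(x, t). f x t)"
    and "exact_solution \<alpha> l T p \<phi> f u"
    and "regularity_bounds \<alpha> l T C\<^sub>u u"
  shows "\<exists>C>0. \<forall>N\<ge>2. \<forall>M\<ge>1. \<forall>U.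
           implicit_scheme_solution \<alpha> l T r p \<phi> f N M U \<longrightarrow>
           Max ((\<lambda>k. discrete_max_norm N
                  (\<lambda>i. u (grid_point l N i) (mesh_time T r M k) - U i k)) ` {0..M})
           \<le> C * (real M powr (- min (2 - \<alpha>) (r * \<alpha>)) + (l / real N)\<^sup>2)"
proof -
  define \<beta> where "\<beta> = min (2 - \<alpha>) (r * \<alpha>)"
  \<comment> \<open>\<open>c\<close> dominates both truncation constants; the summand 1 makes it
    positive. \<open>C\<close> is then chosen so that the stability condition at level
    \<open>k\<close> reduces to the lower bound \<open>d_low\<close> on
    \<open>d k 1\<close>.\<close>
  define c where "c = \<bar>L1_truncation_const \<alpha> T r C\<^sub>u\<bar> + \<bar>C\<^sub>u\<bar> + 1"
  define C where "C = Gamma (2 - \<alpha>) * c * T powr \<alpha> / (1 - \<alpha>)"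
  have G: "0 < Gamma (2 - \<alpha>)" using assms(2) by (intro Gamma_real_pos) auto
  have "0 < c" unfolding c_def by linarith
  then have C: "0 < C" using assms G by (simp add: C_def)
  show ?thesis
  proof (intro exI[of _ C] conjI C allI impI)
    fix N M :: nat and U
    assume N: "2 \<le> N" and M: "1 \<le> M" and U: "implicit_scheme_solution \<alpha> l T r p \<phi> f N M U"
    define t x h where "t = mesh_time T r M" and "x = grid_point l N" and "h = l / real N"
    define e where "e = (\<lambda>i k. u (x i) (t k) - U i k)"
    define d where "d = L1_weight \<alpha> T r M"
    define B where "B = C * (real M powr (-\<beta>) + h\<^sup>2)"
    \<comment> \<open>\<open>R\<close> is by definition the residual of the error in the scheme, so
      the equation required by \<open>scheme_stability\<close> holds trivially and the work lies in
      bounding \<open>R\<close>.\<close>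
    define R where "R = (\<lambda>i k. 1 / Gamma (2 - \<alpha>) * (\<Sum>j = 1..k. d k j * (e i j - e i (j - 1)))
       - (e (i + 1) k - 2 * e i k + e (i - 1) k) / h\<^sup>2 + p (t k) * e i k)"
    interpret graded_mesh \<alpha> r "T / real M powr r" t
      unfolding t_def using assms M by (intro graded_mesh_mesh_time) auto
    have h: "0 < h" using assms N by (simp add: h_def)
    have x: "x i = real i * h" for i by (simp add: x_def h_def grid_point_def)
    have x_in: "x i \<in> {0..l}" if "i \<le> N" for i
      using that assms N by (auto simp: x_def grid_point_def field_simps)
    have t_in: "t k \<in> {0..T}" if "k \<le> M" for k
      using mesh_time_bounds[of r T k M] that assms by (simp add: t_def)
    have trunc: "\<bar>R i k\<bar> \<le> c * (real k powr (-\<beta>) + h\<^sup>2)"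
      if i: "1 \<le> i" "i < N" and k: "1 \<le> k" "k \<le> M" for i k
    proof -
      define L where "L = 1 / Gamma (2 - \<alpha>) * (\<Sum>j = 1..k. d k j * (u (x i) (t j) - u (x i) (t (j - 1))))
         - caputo \<alpha> (u (x i)) (t k)"
      define X where "X = (u (x i + h) (t k) - 2 * u (x i) (t k) + u (x i - h) (t k)) / h\<^sup>2
         - nth_deriv_on {0..l} 2 (\<lambda>y. u y (t k)) (x i)"
      have xi: "x i \<in> {0<..<l}" "x (i + 1) = x i + h" "x (i - 1) = x i - h" "x i - h \<ge> 0" "x i + h \<le> l"
        using i h x_in[of "i - 1"] x_in[of "i + 1"] by (auto simp: x algebra_simps of_nat_diff)
      have tk: "0 < t k" "t k \<in> {0<..T}" using t_pos[of k] t_in[of k] k by auto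
      have "1 / Gamma (2 - \<alpha>) * (\<Sum>j = 1..k. d k j * (U i j - U i (j - 1)))
         - (U (i + 1) k - 2 * U i k + U (i - 1) k) / h\<^sup>2 + p (t k) * U i k = f (x i) (t k)"
        using U i k by (auto simp: implicit_scheme_solution_def d_def h_def t_def x_def)
      moreover have "caputo \<alpha> (u (x i)) (t k) - nth_deriv_on {0..l} 2 (\<lambda>y. u y (t k)) (x i)
         + p (t k) * u (x i) (t k) = f (x i) (t k)"
        using assms(10) xi(1) t_in k by (auto simp: exact_solution_def)
      moreover have "1 / Gamma (2 - \<alpha>) * (\<Sum>j = 1..k. d k j * (e i j - e i (j - 1))) =
         1 / Gamma (2 - \<alpha>) * (\<Sum>j = 1..k. d k j * (u (x i) (t j) - u (x i) (t (j - 1))))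
         - 1 / Gamma (2 - \<alpha>) * (\<Sum>j = 1..k. d k j * (U i j - U i (j - 1)))"
      proof -
        have "(\<Sum>j = 1..k. d k j * (e i j - e i (j - 1))) =
            (\<Sum>j = 1..k. d k j * (u (x i) (t j) - u (x i) (t (j - 1))))
            - (\<Sum>j = 1..k. d k j * (U i j - U i (j - 1)))"
          unfolding sum_subtractf[symmetric] by (intro sum.cong) (simp_all add: e_def algebra_simps)
        then show ?thesis by (simp only: right_diff_distrib)
      qed
      moreover have "(e (i + 1) k - 2 * e i k + e (i - 1) k) / h\<^sup>2 =
         (u (x i + h) (t k) - 2 * u (x i) (t k) + u (x i - h) (t k)) / h\<^sup>2
         - (U (i + 1) k - 2 * U i k + U (i - 1) k) / h\<^sup>2"
        by (simp only: e_def xi(2,3)) (simp add: diff_divide_distrib add_divide_distrib)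
      \<comment> \<open>The right-hand side \<open>f\<close> cancels between the scheme and the
        differential equation, leaving the time error \<open>L\<close> minus the space error
        \<open>X\<close>.\<close>
      ultimately have RLX: "R i k = L - X"
        unfolding R_def L_def X_def by (simp add: e_def right_diff_distrib)
      have reg: "\<bar>nth_deriv_on {0..l} m (\<lambda>y. u y s) z\<bar> \<le> C\<^sub>u"
        "\<bar>nth_deriv_on {0<..T} m' (u z) s\<bar> \<le> C\<^sub>u * (1 + s powr (\<alpha> - real m'))"
        if "z \<in> {0..l}" "s \<in> {0<..T}" "m \<in> {0..4}" "m' \<in> {0..2}" for m m' z s
        using assms(11) that unfolding regularity_bounds_def by blast+
      have "\<bar>L\<bar> \<le> L1_truncation_const \<alpha> T r C\<^sub>u * real k powr (-\<beta>)"
        unfolding L_def d_def t_def \<beta>_def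
      proof (rule L1_truncation_error)
        show "continuous_on {0..T} (u (x i))" "caputo_exists_on \<alpha> (u (x i)) T"
          using assms(10) xi(1) by (auto simp: exact_solution_def)
        show "times_differentiable_on 2 (u (x i)) {0<..T}"
          using assms(11) xi(1) by (auto simp: regularity_bounds_def)
        show "\<bar>nth_deriv_on {0<..T} m (u (x i)) s\<bar> \<le> C\<^sub>u * (1 + s powr (\<alpha> - real m))"
          if "s \<in> {0<..T}" "m \<in> {0..2}" for s m
          using reg(2)[of "x i" s 0 m] that xi(1) by simp
      qed (use assms k in auto)
      also have "\<dots> \<le> \<bar>L1_truncation_const \<alpha> T r C\<^sub>u\<bar> * real k powr (-\<beta>)"
        by (intro mult_right_mono) auto
      also have "\<dots> \<le> c * real k powr (-\<beta>)"
        by (intro mult_right_mono) (auto simp: c_def)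
      finally have L: "\<bar>L\<bar> \<le> c * real k powr (-\<beta>)" .
      have "\<bar>X\<bar> \<le> C\<^sub>u * h\<^sup>2"
        unfolding X_def
      proof (rule central_difference_error)
        show "times_differentiable_on 4 (\<lambda>y. u y (t k)) {0..l}"
          using assms(11) tk by (auto simp: regularity_bounds_def)
        show "\<bar>nth_deriv_on {0..l} 4 (\<lambda>y. u y (t k)) z\<bar> \<le> C\<^sub>u" if "z \<in> {0..l}" for z
          using reg(1)[of z "t k" 4 0] that tk by simp
      qed (use h xi in auto)
      also have "\<dots> \<le> c * h\<^sup>2" by (intro mult_right_mono) (auto simp: c_def)
      finally have "\<bar>X\<bar> \<le> c * h\<^sup>2" .
      with L show ?thesis unfolding RLX by (simp add: distrib_left)
    qed
    have d_low: "(1 - \<alpha>) * t k powr (-\<alpha>) \<le> d k 1" if "1 \<le> k" "k \<le> M" for k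
      using L1_weight_bounds(1)[of \<alpha> "t 0" "t 1" "t k"] assms that t_pos[of 1] t_mono[of 1 k]
      by (simp add: d_def L1_weight_def t_def[symmetric])
    have e: "\<bar>e i k\<bar> \<le> B" if "k \<le> M" "i \<le> N" for i k
    proof (rule scheme_stability[of "Gamma (2 - \<alpha>)" h B M d "\<lambda>k. p (t k)" N e R, OF G h])
      show "0 \<le> B" using C by (simp add: B_def)
      show "0 < d k 1" if "1 \<le> k" "k \<le> M" for k
        using d_low[OF that] assms(2) t_pos[OF that(1)] by (smt (verit) mult_pos_pos powr_gt_zero)
      \<comment> \<open>Both weights are compared with the kernel at their common mesh point
        \<open>t j\<close>. The lower bound on the second also holds for \<open>Suc j = k\<close>,
        where its interval ends at \<open>t k\<close>.\<close>
      show "d k j \<le> d k (Suc j)" if "k \<le> M" "1 \<le> j" "j < k" for k j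
      proof -
        have "d k j \<le> (1 - \<alpha>) * (t k - t j) powr (-\<alpha>)"
          using L1_weight_bounds(2)[of \<alpha> "t (j - 1)" "t j" "t k"] assms that
            t_strict_mono[of "j - 1" j] t_strict_mono[of j k]
          by (simp add: d_def L1_weight_def t_def[symmetric])
        also have "\<dots> \<le> d k (Suc j)"
          using L1_weight_bounds(1)[of \<alpha> "t j" "t (Suc j)" "t k"] assms that
            t_strict_mono[of j "Suc j"] t_mono[of "Suc j" k]
          by (simp add: d_def L1_weight_def t_def[symmetric])
        finally show ?thesis .
      qed
      show "0 \<le> p (t k)" if "1 \<le> k" "k \<le> M" for k
        using assms(7) t_in that by blast
      show "e i 0 = 0" if "i \<le> N" for i
        using U x_in[OF that] that assms(10)
        by (simp add: e_def implicit_scheme_solution_def exact_solution_def x_def[symmetric])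
      show "e 0 k = 0 \<and> e N k = 0" if "k \<le> M" for k
        using U t_in[OF that] that assms(10) N
        by (simp add: e_def implicit_scheme_solution_def exact_solution_def x h_def)
      show "Gamma (2 - \<alpha>) * \<bar>R i k\<bar> \<le> d k 1 * B" if i: "1 \<le> i" "i < N" and k: "1 \<le> k" "k \<le> M" for i k
      proof -
        \<comment> \<open>Up to the factor \<open>T powr \<alpha>\<close> this is
          \<open>t k powr (-\<alpha>)\<close>, the growth of \<open>d k 1\<close> at early levels.
          It compensates for the larger time error there, because \<open>k / M \<le> 1\<close> and
          \<beta> \<le> r * \<alpha>; being at least 1, it also covers the spatial term.\<close>
        define \<rho> where "\<rho> = (real k / real M) powr (- (r * \<alpha>))"
        have q: "0 < real k / real M" "real k / real M \<le> 1" using k by auto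
        have "real k powr (-\<beta>) = (real k / real M) powr (-\<beta>) * real M powr (-\<beta>)"
          using k by (simp add: powr_divide)
        also have "\<dots> \<le> \<rho> * real M powr (-\<beta>)"
          unfolding \<rho>_def using q by (intro mult_right_mono powr_mono') (auto simp: \<beta>_def)
        finally have "real k powr (-\<beta>) \<le> \<rho> * real M powr (-\<beta>)" .
        moreover have "1 \<le> \<rho>"
          unfolding \<rho>_def using k powr_mono'[of "- (r * \<alpha>)" 0 "real k / real M"] assms(1,5) by simp
        then have "h\<^sup>2 \<le> \<rho> * h\<^sup>2" using mult_right_mono[of 1 \<rho> "h\<^sup>2"] by simp
        ultimately have "real k powr (-\<beta>) + h\<^sup>2 \<le> \<rho> * (real M powr (-\<beta>) + h\<^sup>2)"
          by (simp add: distrib_left)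
        then have "\<bar>R i k\<bar> \<le> c * (\<rho> * (real M powr (-\<beta>) + h\<^sup>2))"
          using trunc[OF i k] \<open>0 < c\<close> by (meson mult_left_mono less_imp_le order_trans)
        then have "Gamma (2 - \<alpha>) * \<bar>R i k\<bar> \<le> Gamma (2 - \<alpha>) * (c * (\<rho> * (real M powr (-\<beta>) + h\<^sup>2)))"
          using G by (intro mult_left_mono) auto
        also have "\<dots> = (1 - \<alpha>) * t k powr (-\<alpha>) * B"
        proof -
          have "t k powr (-\<alpha>) = T powr (-\<alpha>) * \<rho>"
            unfolding \<rho>_def t_def mesh_time_def by (simp add: powr_mult powr_powr)
          then show ?thesis
            using assms by (simp add: B_def C_def powr_minus)
        qed
        also have "\<dots> \<le> d k 1 * B"
          using d_low[OF k] C by (intro mult_right_mono) (auto simp: B_def)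
        finally show ?thesis .
      qed
    qed (use that in \<open>simp_all add: R_def\<close>)
    show "Max ((\<lambda>k. discrete_max_norm N
                  (\<lambda>i. u (grid_point l N i) (mesh_time T r M k) - U i k)) ` {0..M})
           \<le> C * (real M powr (- min (2 - \<alpha>) (r * \<alpha>)) + (l / real N)\<^sup>2)"
      using e by (simp add: discrete_max_norm_def e_def B_def \<beta>_def h_def t_def x_def)
  qed
qed

end
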